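(* Let $X=(X_1,X_2,\dots)$, $Y=(Y_1,Y_2,\dots)$ be indeterminates and $t$ a parameter. Consider the (formal) Hall–Littlewood measure on the set $\mathcal{P}$ of all partitions, $\mathrm{P}_{\mathrm{HL},X,Y,t}(\{\lambda\})=\frac1ZQ_\lambda(X;t)P_\lambda(Y;t)$ with $Z=\sum_{\lambda\in\mathcal{P}}Q_\lambda(X;t)P_\lambda(Y;t)=\prod_{i,j\ge1}\frac{1-tX_iY_j}{1-X_iY_j}$. Then the mean $\mathbb{E}(|\lambda|)=\frac1Z\sum_\lambda|\lambda|Q_\lambda(X;t)P_\lambda(Y;t)$ and variance $\mathrm{Var}(|\lambda|)=\mathbb{E}(|\lambda|^2)-\mathbb{E}(|\lambda|)^2$ of the size $|\lambda|$ are $$\mathbb{E}(|\lambda|)=\sum_{k=1}^\infty(1-t^k)p_k(X)p_k(Y),\qquad \mathrm{Var}(|\lambda|)=\sum_{k=1}^\infty k(1-t^k)p_k(X)p_k(Y),$$ where $p_k(X)=\sum_iX_i^k$ is the $k$-th power sum.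
   Context: $Q_\lambda(X;t)$ and $P_\lambda(X;t)$ are the Hall–Littlewood $Q$- and $P$-functions of a partition $\lambda$ (as in Macdonald, Symmetric Functions and Hall Polynomials, Ch. III); $|\lambda|$ is the size of $\lambda$. All quantities are understood as formal power series in the variables. *)

theory Defs
  imports "HOL-Library.Poly_Mapping" "HOL-Computational_Algebra.Polynomial"
          "HOL-Combinatorics.Permutations"
begin

definition is_partition :: "nat list \<Rightarrow> bool" where
  "is_partition lam \<longleftrightarrow> sorted_wrt (\<ge>) lam \<and> 0 \<notin> set lam"

definition psize :: "nat list \<Rightarrow> nat" where
  "psize lam = sum_list lam"

definition part :: "nat list \<Rightarrow> nat \<Rightarrow> nat" where
  "part lam i = (if i < length lam then lam ! i else 0)"

definition pmult :: "nat \<Rightarrow> nat list \<Rightarrow> nat \<Rightarrow> nat" where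
  "pmult n lam i = card {k. k < n \<and> part lam k = i}"

definition tt :: "int poly" where "tt = [:0, 1:]"

text \<open>v_m(t) = prod_{i=1}^m (1-t^i)/(1-t) = prod_{i=1}^m (1 + t + ... + t^(i-1))\<close>
definition vm :: "nat \<Rightarrow> int poly" where
  "vm m = (\<Prod>i=1..m. \<Sum>j<i. tt ^ j)"

text \<open>v_lambda(t) for n variables = prod_{i>=0} v_{m_i}(t), with m_0 = n - l(lambda).\<close>
definition vlam :: "nat \<Rightarrow> nat list \<Rightarrow> int poly" where
  "vlam n lam = (\<Prod>i\<in>{0..(if lam = [] then 0 else hd lam)}. vm (pmult n lam i))"

definition phim :: "nat \<Rightarrow> int poly" where
  "phim m = (\<Prod>i=1..m. 1 - tt ^ i)"

definition blam :: "nat list \<Rightarrow> int poly" where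
  "blam lam = (\<Prod>i\<in>{1..(if lam = [] then 0 else hd lam)}. phim (pmult (length lam) lam i))"

section \<open>Hall--Littlewood P in finitely many variables (Macdonald III (2.2))\<close>

type_synonym mpoly = "(nat \<Rightarrow>\<^sub>0 nat) \<Rightarrow>\<^sub>0 int poly"

definition Xv :: "nat \<Rightarrow> mpoly" where
  "Xv k = Poly_Mapping.single (Poly_Mapping.single k 1) 1"

definition Cst :: "int poly \<Rightarrow> mpoly" where
  "Cst c = Poly_Mapping.single 0 c"

definition vandermonde :: "nat \<Rightarrow> mpoly" where
  "vandermonde n = (\<Prod>(i,j)\<in>{(i,j). i < j \<and> j < n}. Xv i - Xv j)"

definition antisymHL :: "nat \<Rightarrow> nat list \<Rightarrow> mpoly" where
  "antisymHL n lam = (\<Sum>w\<in>{w. w permutes {..<n}}.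
      of_int (sign w) * (\<Prod>i<n. Xv (w i) ^ part lam i)
        * (\<Prod>(i,j)\<in>{(i,j). i < j \<and> j < n}. Xv (w i) - Cst tt * Xv (w j)))"

text \<open>P_lambda(x_1..x_n;t) = (1/v_lambda(t)) sum_{w in S_n} w(x^lambda prod_{i<j}(x_i-t x_j)/(x_i-x_j)),
  i.e. the unique polynomial p with v_lambda(t) * p * Delta = antisymHL; zero if l(lambda) > n.\<close>
definition HLPn :: "nat \<Rightarrow> nat list \<Rightarrow> mpoly" where
  "HLPn n lam = (if length lam > n then 0
     else (THE p. Cst (vlam n lam) * p * vandermonde n = antisymHL n lam))"

text \<open>A formal power series in variables indexed by nat is a coefficient function on monomials.\<close>
type_synonym fps1 = "(nat \<Rightarrow>\<^sub>0 nat) \<Rightarrow> int poly"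
type_synonym fps2 = "(nat \<Rightarrow>\<^sub>0 nat) \<times> (nat \<Rightarrow>\<^sub>0 nat) \<Rightarrow> int poly"

text \<open>Number of variables sufficient to read off the coefficient of alpha (stability, Macdonald III.2).\<close>
definition nvars :: "(nat \<Rightarrow>\<^sub>0 nat) \<Rightarrow> nat list \<Rightarrow> nat" where
  "nvars \<alpha> lam = Suc (Max (insert 0 (Poly_Mapping.keys \<alpha>))) + length lam"

text \<open>P_lambda(X;t) as element of the inverse limit: coefficient of x^alpha.\<close>
definition HLP :: "nat list \<Rightarrow> fps1" where
  "HLP lam \<alpha> = Poly_Mapping.lookup (HLPn (nvars \<alpha> lam) lam) \<alpha>"

text \<open>Q_lambda = b_lambda(t) P_lambda (Macdonald III (2.11)).\<close>
definition HLQ :: "nat list \<Rightarrow> fps1" where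
  "HLQ lam \<alpha> = blam lam * HLP lam \<alpha>"

definition tensor :: "fps1 \<Rightarrow> fps1 \<Rightarrow> fps2" where
  "tensor f g m = f (fst m) * g (snd m)"

definition powsum :: "nat \<Rightarrow> fps1" where
  "powsum k \<alpha> = (if \<exists>i. \<alpha> = Poly_Mapping.single i k then 1 else 0)"

text \<open>Formal (coefficientwise) sum of a family of series, each coefficient being a finite sum.\<close>
definition fsum :: "('i \<Rightarrow> 'm \<Rightarrow> int poly) \<Rightarrow> 'i set \<Rightarrow> 'm \<Rightarrow> int poly" where
  "fsum F I m = (\<Sum>i\<in>{i\<in>I. F i m \<noteq> 0}. F i m)"

definition ps_scale :: "int poly \<Rightarrow> ('m \<Rightarrow> int poly) \<Rightarrow> 'm \<Rightarrow> int poly" where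
  "ps_scale c f m = c * f m"

definition ps_minus :: "fps2 \<Rightarrow> fps2 \<Rightarrow> fps2" where
  "ps_minus f g m = f m - g m"

definition ps_mult :: "fps2 \<Rightarrow> fps2 \<Rightarrow> fps2" where
  "ps_mult f g m = (\<Sum>(a,b)\<in>{(a,b). fst a + fst b = fst m \<and> snd a + snd b = snd m}. f a * g b)"

definition ps_div :: "fps2 \<Rightarrow> fps2 \<Rightarrow> fps2" where
  "ps_div f g = (THE h. ps_mult g h = f)"

definition HL_Z :: fps2 where
  "HL_Z = fsum (\<lambda>lam. tensor (HLQ lam) (HLP lam)) {lam. is_partition lam}"

definition HL_mean :: fps2 where
  "HL_mean = ps_div (fsum (\<lambda>lam. ps_scale (of_nat (psize lam)) (tensor (HLQ lam) (HLP lam)))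
                           {lam. is_partition lam}) HL_Z"

definition HL_second_moment :: fps2 where
  "HL_second_moment = ps_div (fsum (\<lambda>lam. ps_scale (of_nat (psize lam ^ 2)) (tensor (HLQ lam) (HLP lam)))
                           {lam. is_partition lam}) HL_Z"

definition HL_var :: fps2 where
  "HL_var = ps_minus HL_second_moment (ps_mult HL_mean HL_mean)"

end

theory Submission
  imports Defs "HOL-Computational_Algebra.Polynomial_FPS" "HOL-Computational_Algebra.Polynomial_Factorial"
    "HOL-Combinatorics.Multiset_Permutations" "HOL-Library.Product_Plus"
begin

text \<open>
  Let $q_r$ be the coefficient of $u^r$ in $\prod_i (1 - t x_i u)/(1 - x_i u)$ and
  $q_\nu = \prod_j q_{\nu_j}$.  Partial fractions give
  $q_r = (1-t) \sum_i x_i^r \prod_{j \ne i} (x_i - t x_j)/(x_i - x_j)$, from which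
  $Q_\lambda = \sum_\nu A_{\lambda\nu} q_\nu$ with $A$ unitriangular for the lexicographic order.
  The coefficient matrix $H$ of the $q_\nu$ on monomials satisfies
  $|\alpha|\, H(\alpha,\beta) = \sum_{k,i,j} (1-t^k)\, H(\alpha - k e_i, \beta - k e_j)$ by Newton's
  identities for $q_r$, so it is symmetric and does not depend on the number of variables.  The lexicographically
  leading term of the symmetrised product shows that $Q_\lambda$ has leading term $b_\lambda x^\lambda$, so $AH$ is
  triangular in the opposite direction and $A H A^T$, being symmetric, is the diagonal matrix of the $b_\lambda$.
  This yields the Cauchy identity, that is, $Z$ has coefficients $H(\alpha,\beta)$.  The recursion for $H$ now reads
  $D Z = Z \cdot \sum_k (1-t^k) p_k(X) p_k(Y)$ for the Euler operator $D$, which multiplies the $\lambda$ term of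
  $Z$ by $|\lambda|$; applying $D$ once and twice gives the two moments.
\<close>

section \<open>The functions $q_r$\<close>

text \<open>The given P_lambda is a \<open>THE\<close>, so a quotient of \<open>antisymHL\<close> by
  v_lambda and the Vandermonde product must be exhibited with coefficients in Z[t]. This
  divisibility falls out of the matrix argument: A is unitriangular over Z[t], so C = A^(-1) has
  entries in Z[t] too, and A H A^T = diag(b) becomes A H = diag(b) C^T. Every coefficient of
  Q_lambda is thus b_lambda times an entry of C, and these entries are the coefficients of P_lambda.
  The same C gives H = C diag(b) C^T, the Cauchy identity. The summands of the symmetrisation are
  rational functions whose denominators cancel only in the total, hence the work in the field of
  fractions of \<open>mpoly\<close> and a notion of leading exponent for quotients. Peeling off the
  parts of lambda removes one variable at a time, so the expansion in the q_nu must hold for every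
  finite variable set S with the same coefficients; this uniformity also makes P_lambda independent
  of the number of variables.\<close>

definition hlq_gf :: "'a::comm_ring_1 \<Rightarrow> (nat \<Rightarrow> 'a) \<Rightarrow> nat set \<Rightarrow> 'a fps" where
  "hlq_gf t x S = (\<Prod>i\<in>S. Abs_fps (\<lambda>m. if m = 0 then 1 else (1 - t) * x i ^ m))"

definition hlq :: "'a::comm_ring_1 \<Rightarrow> (nat \<Rightarrow> 'a) \<Rightarrow> nat set \<Rightarrow> nat \<Rightarrow> 'a" where
  "hlq t x S r = fps_nth (hlq_gf t x S) r"

text \<open>Characterises a factor of \<open>hlq_gf\<close> as (1 - t z u)/(1 - z u) without
  dividing, so that \<open>hlq\<close> makes sense both over \<open>mpoly\<close> and over its field
  of fractions.\<close>

lemma hlq_factor_mult: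
  fixes t z :: "'a::comm_ring_1"
  shows "Abs_fps (\<lambda>m. if m = 0 then 1 else (1 - t) * z ^ m) * (1 - fps_const z * fps_X)
    = 1 - fps_const (t * z) * fps_X"
proof (rule fps_ext)
  fix n
  show "fps_nth (Abs_fps (\<lambda>m. if m = 0 then 1 else (1 - t) * z ^ m) * (1 - fps_const z * fps_X)) n
    = fps_nth (1 - fps_const (t * z) * fps_X) n"
    by (cases n) (auto simp: right_diff_distrib mult.assoc[symmetric] fps_mult_nth_0, auto simp: algebra_simps)
qed

lemma geometric_fps_mult:
  fixes z :: "'a::comm_ring_1"
  shows "Abs_fps (\<lambda>m. z ^ m) * (1 - fps_const z * fps_X) = 1"
proof (rule fps_ext)
  fix n
  show "fps_nth (Abs_fps (\<lambda>m. z ^ m) * (1 - fps_const z * fps_X)) n = fps_nth 1 n"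
    by (cases n) (auto simp: right_diff_distrib mult.assoc[symmetric])
qed

lemma fps_nth_0_prod: "fps_nth (prod f A) 0 = (\<Prod>i\<in>A. fps_nth (f i) 0)"
  by (induction A rule: infinite_finite_induct) auto

lemma hlq_0 [simp]: "hlq t x S 0 = 1"
  by (simp add: hlq_def hlq_gf_def fps_nth_0_prod)

lemma hlq_empty [simp]: "hlq t x {} r = (if r = 0 then 1 else 0)"
  by (simp add: hlq_def hlq_gf_def)

lemma hlq_insert:
  assumes "finite S" "i \<notin> S"
  shows "hlq t x (insert i S) r = (\<Sum>m=0..r. (if m = 0 then 1 else (1 - t) * x i ^ m) * hlq t x S (r - m))"
  using assms by (simp add: hlq_def hlq_gf_def fps_mult_nth)

text \<open>The coefficients of $(1 - u)/(1 - t u)$, the inverse of a factor of the generating function.\<close>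
definition hlq_inv_coeff :: "'a::comm_ring_1 \<Rightarrow> nat \<Rightarrow> 'a" where
  "hlq_inv_coeff t m = (if m = 0 then 1 else (t - 1) * t ^ (m - 1))"

text \<open>Deleting x_i multiplies the generating function by (1 - x_i u)/(1 - t x_i u). This
  rewrites functions of the variables S - {i} through functions of S with powers of x_i as
  coefficients.\<close>

lemma hlq_remove:
  assumes "finite S" "i \<in> S"
  shows "hlq t x (S - {i}) r = (\<Sum>m=0..r. hlq_inv_coeff t m * x i ^ m * hlq t x S (r - m))"
proof -
  define G where "G = Abs_fps (\<lambda>m. hlq_inv_coeff t m * x i ^ m)"
  define F where "F = Abs_fps (\<lambda>m. if m = 0 then 1 else (1 - t) * x i ^ m)"
  define g where "g = Abs_fps (\<lambda>m. (t * x i) ^ m)"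
  have G: "G = (1 - fps_const (x i) * fps_X) * g"
  proof (rule fps_ext)
    fix n
    show "fps_nth G n = fps_nth ((1 - fps_const (x i) * fps_X) * g) n"
      by (cases n) (auto simp: G_def g_def hlq_inv_coeff_def algebra_simps power_mult_distrib)
  qed
  have "G * F = g * (F * (1 - fps_const (x i) * fps_X))"
    by (simp add: G mult_ac)
  also have "\<dots> = g * (1 - fps_const (t * x i) * fps_X)"
    by (simp only: F_def hlq_factor_mult)
  also have "\<dots> = 1" by (simp only: g_def geometric_fps_mult)
  finally have GF: "G * F = 1" .
  have "hlq_gf t x S = F * hlq_gf t x (S - {i})"
    using assms by (simp add: hlq_gf_def F_def prod.remove)
  then have "G * hlq_gf t x S = hlq_gf t x (S - {i})"
    using GF by (simp add: mult.assoc[symmetric])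
  then have "hlq t x (S - {i}) r = fps_nth (G * hlq_gf t x S) r"
    by (simp add: hlq_def)
  then show ?thesis by (simp add: fps_mult_nth G_def hlq_def)
qed

text \<open>Apply u d/du to the generating function: u times the logarithmic derivative of one
  factor is z u/(1 - z u) - t z u/(1 - t z u), with coefficient (1 - t^k) z^k at u^k. The factors 1
  - t^k of both moments originate here.\<close>

lemma hlq_newton:
  fixes t :: "'a::comm_ring_1"
  assumes "finite S"
  shows "of_nat r * hlq t x S r = (\<Sum>k=1..r. (1 - t ^ k) * (\<Sum>i\<in>S. x i ^ k) * hlq t x S (r - k))"
proof -
  define F where "F = (\<lambda>z. Abs_fps (\<lambda>m. if m = 0 then 1 else (1 - t) * z ^ m))"
  define L where "L = (\<lambda>z. Abs_fps (\<lambda>k. (1 - t ^ k) * z ^ k))"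
  have FL: "fps_X * fps_deriv (F z) = F z * L z" for z
  proof -
    have "fps_nth (F z * L z) n = (\<Sum>i=0..n. (if i = 0 then 1 else 1 - t) * (1 - t ^ (n - i))) * z ^ n" for n
      unfolding fps_mult_nth F_def L_def sum_distrib_right
    proof (intro sum.cong refl)
      fix i assume i: "i \<in> {0..n}"
      have z: "z ^ i * z ^ (n - i) = z ^ n" using i by (simp add: power_add[symmetric])
      then show "fps_nth (Abs_fps (\<lambda>m. if m = 0 then 1 else (1 - t) * z ^ m)) i *
          fps_nth (Abs_fps (\<lambda>k. (1 - t ^ k) * z ^ k)) (n - i)
        = (if i = 0 then 1 else 1 - t) * (1 - t ^ (n - i)) * z ^ n"
        unfolding z[symmetric] by (cases "i = 0") (simp_all add: mult_ac)
    qed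
    moreover have "(\<Sum>i=0..n. (if i = 0 then 1 else 1 - t) * (1 - t ^ (n - i))) = of_nat n * (1 - t)" for n
    proof -
      have "(\<Sum>i=0..n. (if i = 0 then 1 else 1 - t) * (1 - t ^ (n - i)))
        = (1 - t ^ n) + (\<Sum>i=1..n. (1 - t) * (1 - t ^ (n - i)))"
        by (subst sum.atLeast_Suc_atMost) simp_all
      also have "(\<Sum>i=1..n. (1 - t) * (1 - t ^ (n - i))) = (\<Sum>i<n. (1 - t) * (1 - t ^ i))"
        by (rule sum.reindex_bij_witness[of _ "\<lambda>i. n - i" "\<lambda>i. n - i"]) auto
      also have "\<dots> = of_nat n * (1 - t) - (1 - t) * (\<Sum>i<n. t ^ i)"
        by (simp add: sum_distrib_left algebra_simps sum_subtractf sum.distrib)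
      also have "(1 - t) * (\<Sum>i<n. t ^ i) = 1 - t ^ n"
        by (simp add: one_diff_power_eq)
      finally show ?thesis by simp
    qed
    ultimately have "fps_nth (F z * L z) n = of_nat n * (1 - t) * z ^ n" for n by simp
    moreover have "fps_nth (fps_X * fps_deriv (F z)) n = of_nat n * (1 - t) * z ^ n" for n
      by (cases n) (auto simp: F_def algebra_simps)
    ultimately show ?thesis by (simp add: fps_eq_iff)
  qed
  have "fps_X * fps_deriv (hlq_gf t x S) = hlq_gf t x S * (\<Sum>i\<in>S. L (x i))"
    using assms
  proof (induction S)
    case empty
    then show ?case by (simp add: hlq_gf_def)
  next
    case (insert i S)
    have "hlq_gf t x (insert i S) = F (x i) * hlq_gf t x S"
      using insert by (simp add: hlq_gf_def F_def)
    then have "fps_X * fps_deriv (hlq_gf t x (insert i S))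
      = (fps_X * fps_deriv (F (x i))) * hlq_gf t x S + F (x i) * (fps_X * fps_deriv (hlq_gf t x S))"
      by (simp add: algebra_simps)
    also have "\<dots> = hlq_gf t x (insert i S) * (\<Sum>i\<in>insert i S. L (x i))"
      unfolding FL insert.IH using insert.hyps \<open>hlq_gf t x (insert i S) = _\<close> by (simp add: algebra_simps)
    finally show ?case .
  qed
  then have "fps_nth (fps_X * fps_deriv (hlq_gf t x S)) r = fps_nth ((\<Sum>i\<in>S. L (x i)) * hlq_gf t x S) r"
    by (simp add: mult.commute)
  moreover have "fps_nth (fps_X * fps_deriv (hlq_gf t x S)) r = of_nat r * hlq t x S r"
    by (cases r) (simp_all add: hlq_def)
  moreover have "fps_nth ((\<Sum>i\<in>S. L (x i)) * hlq_gf t x S) r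
    = (\<Sum>k=0..r. (1 - t ^ k) * (\<Sum>i\<in>S. x i ^ k) * hlq t x S (r - k))"
    by (simp add: fps_mult_nth hlq_def L_def fps_sum_nth sum_distrib_left)
  ultimately show ?thesis
    by (subst (asm) sum.atLeast_Suc_atMost) (simp_all)
qed

lemma prod_linear_degree:
  fixes c :: "nat \<Rightarrow> 'a::comm_ring_1"
  assumes "finite S"
  shows "degree (\<Prod>i\<in>S. [:1, - c i:]) \<le> card S" "coeff (\<Prod>i\<in>S. [:1, - c i:]) (card S) = (\<Prod>i\<in>S. - c i)"
proof -
  have "degree (\<Prod>i\<in>S. [:1, - c i:]) \<le> card S \<and> coeff (\<Prod>i\<in>S. [:1, - c i:]) (card S) = (\<Prod>i\<in>S. - c i)"
    using assms
  proof (induction S)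
    case (insert i S)
    have "degree ([:1, - c i:] * (\<Prod>i\<in>S. [:1, - c i:])) \<le> 1 + card S"
      using insert by (intro order.trans[OF degree_mult_le] add_mono) auto
    moreover have "coeff (\<Prod>i\<in>S. [:1, - c i:]) (Suc (card S)) = 0"
      using insert by (intro coeff_eq_0) auto
    ultimately show ?case using insert by simp
  qed auto
  then show "degree (\<Prod>i\<in>S. [:1, - c i:]) \<le> card S" "coeff (\<Prod>i\<in>S. [:1, - c i:]) (card S) = (\<Prod>i\<in>S. - c i)" by auto
qed

text \<open>Up to the factor 1 - t, the coefficient of 1/(1 - x_i u) in the partial fraction
  expansion of the generating function.\<close>

definition hlg :: "'a::field \<Rightarrow> (nat \<Rightarrow> 'a) \<Rightarrow> nat set \<Rightarrow> nat \<Rightarrow> 'a" where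
  "hlg t x S i = (\<Prod>j\<in>S - {i}. (x i - t * x j) / (x i - x j))"

text \<open>After clearing denominators the difference of the two sides is a polynomial in u of
  degree below \<open>card S\<close> that vanishes at the \<open>card S\<close> points 1/x_k. The
  correction at r = 0 is the value t^(card S) of the generating function at u = infinity.\<close>

lemma hlq_partial_fractions:
  fixes t :: "'a::field"
  assumes "finite S" "inj_on x S" "\<And>i. i \<in> S \<Longrightarrow> x i \<noteq> 0"
  shows "(\<Sum>i\<in>S. (1 - t) * hlg t x S i * x i ^ r) = hlq t x S r - (if r = 0 then t ^ card S else 0)"
proof -
  define P where "P = (\<lambda>c S. \<Prod>i\<in>S. [:1, - (c * x i):])"
  define g where "g = (\<lambda>i. (1 - t) * hlg t x S i)"
  \<comment> \<open>The cleared identity with common denominator \<open>P 1 S\<close>; subtracting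
    t^(card S) times it cancels the coefficient of degree \<open>card S\<close>.\<close>
  define D where "D = P t S - [:t ^ card S:] * P 1 S - (\<Sum>i\<in>S. [:g i:] * P 1 (S - {i}))"
  have D0: "D = 0"
  proof (rule ccontr)
    assume "D \<noteq> 0"
    have nz: "S \<noteq> {}"
      using \<open>D \<noteq> 0\<close> by (auto simp: D_def P_def)
    have deg: "degree (P c S') \<le> card S'" if "finite S'" for c S'
      unfolding P_def by (rule prod_linear_degree[OF that])
    have "degree (\<Sum>i\<in>S. [:g i:] * P 1 (S - {i})) \<le> card S - 1"
    proof (rule degree_sum_le[OF assms(1)])
      fix i assume "i \<in> S"
      then show "degree ([:g i:] * P 1 (S - {i})) \<le> card S - 1"
        using deg[of "S - {i}" 1] assms(1)
        by (intro order.trans[OF degree_mult_le]) simp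
    qed
    moreover have "degree (P t S - [:t ^ card S:] * P 1 S) \<le> card S - 1"
    proof -
      have "degree (P t S - [:t ^ card S:] * P 1 S) \<le> card S"
        using deg[OF assms(1)] by (intro degree_diff_le order.trans[OF degree_mult_le]) auto
      moreover have "coeff (P t S - [:t ^ card S:] * P 1 S) (card S) = 0"
        using prod_linear_degree(2)[OF assms(1), of "\<lambda>i. t * x i"] prod_linear_degree(2)[OF assms(1), of x]
        by (simp add: P_def prod.distrib prod_uminus)
      ultimately have calculation: "degree (P t S - [:t ^ card S:] * P 1 S) \<le> card S"
        "coeff (P t S - [:t ^ card S:] * P 1 S) (card S) = 0" by auto
      show ?thesis
      proof (intro degree_le allI impI)
        fix i assume "card S - 1 < i"
        then have "i = card S \<or> i > card S" by linarith
        then show "coeff (P t S - [:t ^ card S:] * P 1 S) i = 0"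
          using calculation by (metis coeff_eq_0 order.strict_trans1)
      qed
    qed
    ultimately have "degree D \<le> card S - 1"
      unfolding D_def by (rule degree_diff_le[rotated])
    moreover have "card S > 0" using nz assms(1) by (simp add: card_gt_0_iff)
    ultimately have degD: "degree D < card S" by linarith
    have root: "poly D (1 / x k) = 0" if k: "k \<in> S" for k
    proof -
      have xk: "x k \<noteq> 0" using assms(3) k by auto
      have Pk: "poly (P c S') (1 / x k) = (\<Prod>j\<in>S'. (x k - c * x j) / x k)" for c S'
        using xk by (simp add: P_def poly_prod field_simps)
      have "poly (P 1 S) (1 / x k) = 0"
        unfolding Pk using k assms(1) by (intro prod_zero) auto
      moreover have "poly (\<Sum>i\<in>S. [:g i:] * P 1 (S - {i})) (1 / x k) = g k * poly (P 1 (S - {k})) (1 / x k)"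
      proof -
        have "poly (\<Sum>i\<in>S. [:g i:] * P 1 (S - {i})) (1 / x k) = (\<Sum>i\<in>S. if i = k then g k * poly (P 1 (S - {k})) (1 / x k) else 0)"
          unfolding poly_sum
        proof (rule sum.cong[OF refl])
          fix i assume "i \<in> S"
          show "poly ([:g i:] * P 1 (S - {i})) (1 / x k) = (if i = k then g k * poly (P 1 (S - {k})) (1 / x k) else 0)"
            using k assms(1) by (cases "i = k") (auto simp: Pk intro!: prod_zero bexI[of _ k])
        qed
        then show ?thesis using k assms(1) by simp
      qed
      \<comment> \<open>The factor for j = k is (x_k - t x_k)/x_k = 1 - t, the source of the 1 - t
        in \<open>g\<close>.\<close>
      moreover have "poly (P t S) (1 / x k) = g k * poly (P 1 (S - {k})) (1 / x k)"
      proof -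
        have ne: "x k - x j \<noteq> 0" if "j \<in> S - {k}" for j
          using that k assms(2) by (auto simp: inj_on_def)
        have "poly (P t S) (1 / x k) = (1 - t) * (\<Prod>j\<in>S - {k}. (x k - t * x j) / x k)"
          unfolding Pk using k assms(1) xk by (subst prod.remove[OF _ k]) (auto simp: field_simps)
        also have "(\<Prod>j\<in>S - {k}. (x k - t * x j) / x k) = hlg t x S k * (\<Prod>j\<in>S - {k}. (x k - 1 * x j) / x k)"
          unfolding hlg_def prod.distrib[symmetric]
          by (intro prod.cong refl) (use ne in auto)
        finally show ?thesis by (simp add: g_def Pk)
      qed
      ultimately show ?thesis by (simp add: D_def)
    qed
    have "inj_on (\<lambda>k. 1 / x k) S"
      using assms(2,3) by (auto simp: inj_on_def)
    then have "card S = card ((\<lambda>k. 1 / x k) ` S)"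
      by (simp add: card_image)
    also have "\<dots> \<le> card {z. poly D z = 0}"
      using root \<open>D \<noteq> 0\<close> by (intro card_mono poly_roots_finite) auto
    also have "\<dots> \<le> degree D"
      using \<open>D \<noteq> 0\<close> by (rule card_poly_roots_bound)
    finally show False using degD by simp
  qed
  define E where "E = (\<lambda>c S. fps_of_poly (P c S))"
  have E: "E c S' = (\<Prod>i\<in>S'. 1 - fps_const (c * x i) * fps_X)" for c S'
    by (simp add: E_def P_def fps_of_poly_prod fps_of_poly_pCons mult.commute[of fps_X] flip: fps_const_neg)
  have "P t S = smult (t ^ card S) (P 1 S) + (\<Sum>i\<in>S. smult (g i) (P 1 (S - {i})))"
    using D0 by (simp add: D_def algebra_simps)
  then have eq: "E t S = fps_const (t ^ card S) * E 1 S + (\<Sum>i\<in>S. fps_const (g i) * E 1 (S - {i}))"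
    unfolding E_def by (simp add: fps_of_poly_add fps_of_poly_sum fps_of_poly_smult)
  have gf: "hlq_gf t x S * E 1 S = E t S"
    unfolding hlq_gf_def E prod.distrib[symmetric] using hlq_factor_mult[of t] by simp
  \<comment> \<open>\<open>W i\<close> is the expansion of 1/(1 - x_i u). The identity of series
    holds after multiplication by \<open>E 1 S\<close>, which is nonzero and can be
    cancelled.\<close>
  define W where "W = (\<lambda>i. Abs_fps (\<lambda>m. x i ^ m))"
  have W: "W i * E 1 S = E 1 (S - {i})" if "i \<in> S" for i
    unfolding E W_def using that assms(1) geometric_fps_mult[of "x i"]
    by (simp add: prod.remove mult.assoc[symmetric])
  have "(hlq_gf t x S - fps_const (t ^ card S) - (\<Sum>i\<in>S. fps_const (g i) * W i)) * E 1 S = 0"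
    by (simp add: left_diff_distrib gf sum_distrib_right mult.assoc W eq)
  moreover have "E 1 S \<noteq> 0"
  proof -
    have "fps_nth (E 1 S) 0 = 1" by (simp add: E fps_nth_0_prod)
    then show ?thesis by auto
  qed
  ultimately have "hlq_gf t x S - fps_const (t ^ card S) - (\<Sum>i\<in>S. fps_const (g i) * W i) = 0"
    by (metis mult_eq_0_iff)
  then have "hlq_gf t x S = fps_const (t ^ card S) + (\<Sum>i\<in>S. fps_const (g i) * W i)"
    by (simp only: diff_diff_eq right_minus_eq)
  then have "hlq t x S r = fps_nth (fps_const (t ^ card S) + (\<Sum>i\<in>S. fps_const (g i) * W i)) r"
    by (simp add: hlq_def)
  then show ?thesis
    by (simp add: fps_sum_nth g_def W_def)
qed

section \<open>Expansion in products of the $q_r$\<close>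

text \<open>If $\lambda$ is padded with zeros to length $|S|$, this is $v_\lambda P_\lambda$ in the variables
  indexed by $S$; the recursion sums over the variable that receives the first exponent.\<close>
fun hlR :: "'a::field \<Rightarrow> (nat \<Rightarrow> 'a) \<Rightarrow> nat set \<Rightarrow> nat list \<Rightarrow> 'a" where
  "hlR t x S [] = 1"
| "hlR t x S (a # lam) = (\<Sum>i\<in>S. hlg t x S i * x i ^ a * hlR t x (S - {i}) lam)"

definition hlqs :: "'a::comm_ring_1 \<Rightarrow> (nat \<Rightarrow> 'a) \<Rightarrow> nat set \<Rightarrow> nat list \<Rightarrow> 'a" where
  "hlqs t x S nu = prod_list (map (hlq t x S) nu)"

lemma hlqs_simps [simp]:
  "hlqs t x S [] = 1"
  "hlqs t x S (r # nu) = hlq t x S r * hlqs t x S nu"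
  "hlqs t x S (nu @ nu') = hlqs t x S nu * hlqs t x S nu'"
  by (simp_all add: hlqs_def)

section \<open>Partitions and the lexicographic order of their exponent vectors\<close>

abbreviation pexp :: "nat list \<Rightarrow> (nat \<Rightarrow>\<^sub>0 nat)" where
  "pexp \<equiv> Poly_Mapping.nth"

text \<open>Since q_0 = 1 and the q_r commute, a product of q_r depends only on this normal form of
  its index list; the expansions below produce unsorted indices and zeros.\<close>

definition pnorm :: "nat list \<Rightarrow> nat list" where
  "pnorm nu = rev (sort (filter (\<lambda>r. r \<noteq> 0) nu))"

lemma is_partition_pnorm: "is_partition (pnorm nu)"
  unfolding is_partition_def pnorm_def by (auto simp: sorted_wrt_rev)

lemma sum_list_pnorm: "sum_list (pnorm nu) = sum_list nu"
proof -
  have "sum_list (pnorm nu) = sum_mset (mset (filter (\<lambda>r. r \<noteq> 0) nu))"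
    by (metis mset_rev mset_sort pnorm_def sum_mset_sum_list)
  also have "\<dots> = sum_list (filter (\<lambda>r. r \<noteq> 0) nu)"
    by (simp only: sum_mset_sum_list)
  also have "\<dots> = sum_list nu" by (induction nu) auto
  finally show ?thesis .
qed

lemma mset_pnorm: "mset (pnorm nu) = mset (filter (\<lambda>r. r \<noteq> 0) nu)"
  by (simp add: pnorm_def)

lemma hlqs_pnorm: "hlqs t x S (pnorm nu) = hlqs t x S nu"
proof -
  have gen: "hlqs t x S l = prod_mset (image_mset (hlq t x S) (mset l))" for l
    by (simp only: hlqs_def prod_mset_prod_list[symmetric] mset_map)
  have "hlqs t x S (pnorm nu) = hlqs t x S (filter (\<lambda>r. r \<noteq> 0) nu)"
    by (simp only: gen mset_pnorm)
  also have "\<dots> = hlqs t x S nu"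
    by (induction nu) (auto simp: hlqs_def)
  finally show ?thesis .
qed

lemma pnorm_eqI: "mset (filter (\<lambda>r. r \<noteq> 0) nu) = mset (filter (\<lambda>r. r \<noteq> 0) nu') \<Longrightarrow> pnorm nu = pnorm nu'"
  unfolding pnorm_def by (metis properties_for_sort mset_sort sorted_sort)

lemma is_partition_Cons:
  "is_partition (a # mu) \<longleftrightarrow> 0 < a \<and> (\<forall>b\<in>set mu. b \<le> a) \<and> is_partition mu"
  by (auto simp: is_partition_def)

lemma pnorm_partition: "is_partition lam \<Longrightarrow> pnorm lam = lam"
proof -
  assume a: "is_partition lam"
  then have f: "filter (\<lambda>r. r \<noteq> 0) lam = lam"
    by (auto simp: is_partition_def filter_id_conv intro!: Nat.gr0I)
  have "sort lam = rev lam"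
    using a by (intro properties_for_sort) (auto simp: is_partition_def sorted_wrt_rev)
  then show ?thesis unfolding pnorm_def f by simp
qed

lemma set_pnorm: "set (pnorm nu) = set nu - {0}"
  by (auto simp: pnorm_def)

lemma pexp_less_iff:
  "pexp xs < pexp ys \<longleftrightarrow> (\<exists>k. nth_default 0 xs k < nth_default 0 ys k \<and>
     (\<forall>k'<k. nth_default 0 xs k' = nth_default 0 ys k'))"
  by (simp add: less_poly_mapping.rep_eq less_fun_def)

lemma pexp_less_Cons: "pexp xs < pexp ys \<Longrightarrow> pexp (a # xs) < pexp (a # ys)"
  unfolding pexp_less_iff
proof (elim exE conjE)
  fix k assume "nth_default 0 xs k < nth_default 0 ys k" "\<forall>k'<k. nth_default 0 xs k' = nth_default 0 ys k'"
  then show "\<exists>k. nth_default 0 (a # xs) k < nth_default 0 (a # ys) k \<and>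
     (\<forall>k'<k. nth_default 0 (a # xs) k' = nth_default 0 (a # ys) k')"
    by (intro exI[of _ "Suc k"]) (auto simp: less_Suc_eq_0_disj)
qed

lemma pexp_less_of_big_part:
  assumes "b \<in> set nu" "a < b"
  shows "pexp (a # mu) < pexp (pnorm nu)"
proof -
  have b: "b \<in> set (pnorm nu)" using assms by (auto simp: set_pnorm)
  then obtain c rest where c: "pnorm nu = c # rest" by (cases "pnorm nu") auto
  then have "b \<le> c" using is_partition_pnorm[of nu] b by (auto simp: is_partition_Cons)
  then show ?thesis unfolding pexp_less_iff c using assms(2) by (intro exI[of _ 0]) auto
qed

text \<open>If some entry of \<open>nu\<close> exceeds \<open>a\<close>, the first part already
  decides. Otherwise \<open>a\<close> stays in front after sorting and the comparison of the tails
  carries over.\<close>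

lemma pexp_less_pnorm_Cons:
  assumes "pexp mu < pexp (pnorm nu)" "0 < a"
  shows "pexp (a # mu) < pexp (pnorm (a # nu))"
proof (cases "\<exists>b\<in>set nu. a < b")
  case True
  then show ?thesis using pexp_less_of_big_part[of _ "a # nu" a mu] by auto
next
  case False
  have "pnorm (a # nu) = pnorm (a # pnorm nu)"
    by (rule pnorm_eqI) (simp add: mset_pnorm filter_filter_mset)
  also have "\<dots> = a # pnorm nu"
    using False assms(2) is_partition_pnorm[of nu]
    by (intro pnorm_partition) (auto simp: is_partition_Cons set_pnorm)
  finally show ?thesis using pexp_less_Cons[OF assms(1)] by simp
qed

lemma pexp_inj:
  assumes "is_partition lam" "is_partition mu" "pexp lam = pexp mu"
  shows "lam = mu"
proof -
  have "strip_while ((=) 0) nu = nu" if "is_partition nu" for nu :: "nat list"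
    using that by (cases nu rule: rev_cases) (auto simp: is_partition_def)
  then show ?thesis using assms unfolding nth_eq_iff by metis
qed

definition Parts :: "nat \<Rightarrow> nat list set" where
  "Parts d = {lam. is_partition lam \<and> sum_list lam = d}"

lemma length_le_sum_list: "0 \<notin> set xs \<Longrightarrow> length xs \<le> sum_list (xs :: nat list)"
  by (induction xs) auto

lemma finite_Parts [simp]: "finite (Parts d)"
proof (rule finite_subset)
  show "Parts d \<subseteq> {xs. set xs \<subseteq> {..d} \<and> length xs \<le> d}"
    using length_le_sum_list by (auto simp: Parts_def is_partition_def member_le_sum_list)
  show "finite {xs. set xs \<subseteq> {..d} \<and> length xs \<le> d}"
    by (rule finite_lists_length_le) simp
qed

section \<open>Constants and variables in the field of fractions\<close>

lemma Cst_hom [simp]: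
  "Cst 0 = 0" "Cst 1 = 1" "Cst (a + b) = Cst a + Cst b" "Cst (a * b) = Cst a * Cst b"
  "Cst (- a) = - Cst a" "Cst (a - b) = Cst a - Cst b"
  by (simp_all add: Cst_def single_add mult_single single_uminus single_diff)

lemma Cst_power [simp]: "Cst (a ^ n) = Cst a ^ n"
  by (induction n) auto

lemma Cst_eq_iff [simp]: "Cst a = Cst b \<longleftrightarrow> a = b"
  unfolding Cst_def by (metis lookup_single_eq)

definition cK :: "int poly \<Rightarrow> mpoly fract" where "cK c = to_fract (Cst c)"

definition XK :: "nat \<Rightarrow> mpoly fract" where "XK i = to_fract (Xv i)"

lemma cK_hom [simp]:
  "cK 0 = 0" "cK 1 = 1" "cK (a + b) = cK a + cK b" "cK (a * b) = cK a * cK b"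
  "cK (- a) = - cK a" "cK (a - b) = cK a - cK b" "cK a = cK b \<longleftrightarrow> a = b"
  by (simp_all add: cK_def)

lemma cK_power [simp]: "cK (a ^ n) = cK a ^ n"
  by (induction n) auto

lemma cK_eq_0_iff [simp]: "cK a = 0 \<longleftrightarrow> a = 0"
  by (metis cK_hom(1,7))

lemma inj_XK: "XK i = XK j \<longleftrightarrow> i = j"
proof
  assume "XK i = XK j"
  then have "Poly_Mapping.single i (1::nat) = Poly_Mapping.single j 1"
    by (simp add: XK_def Xv_def) (metis lookup_single_eq lookup_single_not_eq one_neq_zero)
  then show "i = j"
    by (metis lookup_single_eq lookup_single_not_eq one_neq_zero)
qed auto

lemma XK_nonzero [simp]: "XK i \<noteq> 0"
proof
  assume "XK i = 0"
  then have "Xv i = 0" by (simp add: XK_def)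
  then show False unfolding Xv_def by (metis lookup_single_eq lookup_zero one_neq_zero)
qed

abbreviation qK :: "nat set \<Rightarrow> nat list \<Rightarrow> mpoly fract" where
  "qK \<equiv> hlqs (cK tt) XK"

text \<open>Members are functions of the variable set, while indices and coefficients are fixed for
  all sets. The induction for \<open>hlR\<close> passes from S to S - {i}, so coefficients depending
  on S would be of no use.\<close>

inductive qspan :: "nat list set \<Rightarrow> (nat set \<Rightarrow> mpoly fract) \<Rightarrow> bool" for U where
  qspan_zero: "qspan U (\<lambda>S. 0)"
| qspan_step: "qspan U F \<Longrightarrow> nu \<in> U \<Longrightarrow> qspan U (\<lambda>S. F S + cK a * qK S nu)"

lemma qspan_mono: "qspan U F \<Longrightarrow> U \<subseteq> V \<Longrightarrow> qspan V F"
  by (induction rule: qspan.induct) (auto intro: qspan.intros)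

lemma qspan_add:
  assumes "qspan U G" "qspan U F"
  shows "qspan U (\<lambda>S. F S + G S)"
  using assms
proof (induction rule: qspan.induct)
  case (qspan_step G nu a)
  then show ?case using qspan.qspan_step[of U "\<lambda>S. F S + G S" nu a] by (simp add: add.assoc)
qed auto

lemma qspan_scale:
  assumes "qspan U F"
  shows "qspan U (\<lambda>S. cK c * F S)"
  using assms
proof (induction rule: qspan.induct)
  case (qspan_step F nu a)
  then show ?case using qspan.qspan_step[of U "\<lambda>S. cK c * F S" nu "c * a"] by (simp add: algebra_simps)
qed (use qspan_zero in simp)

lemma qspan_single: "nu \<in> U \<Longrightarrow> qspan U (\<lambda>S. qK S nu)"
  using qspan_step[OF qspan_zero, of nu U 1] by simp

lemma qspan_sum:
  assumes "\<And>i. i \<in> I \<Longrightarrow> qspan U (F i)"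
  shows "qspan U (\<lambda>S. \<Sum>i\<in>I. F i S)"
  using assms
  by (induction I rule: infinite_finite_induct) (auto intro: qspan_zero qspan_add)

lemma qspan_coeffs:
  assumes "qspan U F"
  shows "\<exists>a. (\<forall>nu. a nu \<noteq> 0 \<longrightarrow> nu \<in> pnorm ` U) \<and>
    (\<forall>d S. U \<subseteq> {nu. sum_list nu = d} \<longrightarrow> F S = (\<Sum>nu\<in>Parts d. cK (a nu) * qK S nu))"
  using assms
proof (induction rule: qspan.induct)
  case qspan_zero
  then show ?case by (intro exI[of _ "\<lambda>_. 0"]) auto
next
  case (qspan_step F nu c)
  then obtain a where a: "\<And>nu. a nu \<noteq> 0 \<Longrightarrow> nu \<in> pnorm ` U"
    "\<And>d S. U \<subseteq> {nu. sum_list nu = d} \<Longrightarrow> F S = (\<Sum>nu\<in>Parts d. cK (a nu) * qK S nu)"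
    by blast
  define a' where "a' = (\<lambda>mu. a mu + (if mu = pnorm nu then c else 0))"
  have "F S + cK c * qK S nu = (\<Sum>nu\<in>Parts d. cK (a' nu) * qK S nu)"
    if U: "U \<subseteq> {nu. sum_list nu = d}" for d S
  proof -
    have "pnorm nu \<in> Parts d"
      using U qspan_step.hyps by (auto simp: Parts_def is_partition_pnorm sum_list_pnorm)
    then have "(\<Sum>mu\<in>Parts d. if mu = pnorm nu then cK c * qK S mu else 0) = cK c * qK S nu"
      by (simp add: hlqs_pnorm)
    moreover have "(\<Sum>mu\<in>Parts d. cK (a' mu) * qK S mu)
      = (\<Sum>mu\<in>Parts d. cK (a mu) * qK S mu) + (\<Sum>mu\<in>Parts d. if mu = pnorm nu then cK c * qK S mu else 0)"
      unfolding sum.distrib[symmetric] by (intro sum.cong) (auto simp: a'_def distrib_right)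
    ultimately show ?thesis using a(2)[OF U] by simp
  qed
  moreover have "\<forall>mu. a' mu \<noteq> 0 \<longrightarrow> mu \<in> pnorm ` U"
    using a(1) qspan_step.hyps by (auto simp: a'_def split: if_splits)
  ultimately show ?case by blast
qed

lemma cK_hlq_inv_coeff: "hlq_inv_coeff (cK tt) m = cK (hlq_inv_coeff tt m)"
  by (simp add: hlq_inv_coeff_def)

text \<open>By \<open>hlq_remove\<close>, the first factor q_b in S - {i} becomes a combination of
  x_i^m q_(b - m) in S. The power x_i^m raises the exponent r to r + m, and q_(b - m), no longer
  dependent on i, moves into \<open>ka\<close>. Once \<open>nu\<close> is used up, partial fractions
  turn the sum over i into a single q; r >= 1 keeps the correction term away.\<close>

lemma hlq_raise:
  assumes "r \<ge> 1"
  shows "\<exists>F. qspan {sg. sum_list sg = r + sum_list nu + sum_list ka \<and> (\<exists>b\<in>set sg. b > r)} F \<and>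
    (\<forall>S. finite S \<longrightarrow> (\<Sum>i\<in>S. (1 - cK tt) * hlg (cK tt) XK S i * XK i ^ r * qK (S - {i}) nu) * qK S ka
      = qK S (r # nu @ ka) + F S)"
  using assms
proof (induction nu arbitrary: r ka)
  case Nil
  have "(\<Sum>i\<in>S. (1 - cK tt) * hlg (cK tt) XK S i * XK i ^ r) = hlq (cK tt) XK S r" if "finite S" for S
    using Nil that by (subst hlq_partial_fractions) (auto simp: inj_on_def inj_XK)
  then show ?case by (intro exI[of _ "\<lambda>S. 0"]) (auto intro: qspan_zero)
next
  case (Cons b nu)
  define U where "U = {sg. sum_list sg = r + sum_list (b # nu) + sum_list ka \<and> (\<exists>b\<in>set sg. b > r)}"
  let ?V = "\<lambda>m. {sg. sum_list sg = (r + m) + sum_list nu + sum_list ((b - m) # ka) \<and> (\<exists>b\<in>set sg. b > r + m)}"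
  let ?L = "\<lambda>r nu S. (\<Sum>i\<in>S. (1 - cK tt) * hlg (cK tt) XK S i * XK i ^ r * qK (S - {i}) nu)"
  have "\<exists>F. \<forall>m. qspan (?V m) (F m) \<and> (\<forall>S. finite S \<longrightarrow> ?L (r + m) nu S * qK S ((b - m) # ka)
      = qK S ((r + m) # nu @ (b - m) # ka) + F m S)"
    by (rule choice, rule allI, rule Cons.IH) (use Cons.prems in simp)
  then obtain F where F: "\<And>m. qspan (?V m) (F m)"
    "\<And>m S. finite S \<Longrightarrow> ?L (r + m) nu S * qK S ((b - m) # ka) = qK S ((r + m) # nu @ (b - m) # ka) + F m S"
    by blast
  \<comment> \<open>\<open>hlq_inv_coeff\<close> is 1 at m = 0, so that term supplies the main
    product and \<open>F 0\<close>; every m >= 1 yields an index r + m > r.\<close>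
  define G where "G = (\<lambda>S. F 0 S + (\<Sum>m=1..b. cK (hlq_inv_coeff tt m) * (qK S ((r + m) # nu @ (b - m) # ka) + F m S)))"
  have FU: "qspan U (F m)" if "m \<le> b" for m
  proof (rule qspan_mono[OF F(1)])
    show "?V m \<subseteq> U" using that unfolding U_def by auto (metis add_lessD1)
  qed
  have "qspan U (\<lambda>S. \<Sum>m=1..b. cK (hlq_inv_coeff tt m) * (qK S ((r + m) # nu @ (b - m) # ka) + F m S))"
    by (intro qspan_sum qspan_scale qspan_add FU qspan_single) (auto simp: U_def)
  then have "qspan U G" unfolding G_def by (intro qspan_add FU) auto
  moreover have "?L r (b # nu) S * qK S ka = qK S (r # (b # nu) @ ka) + G S" if S: "finite S" for S
  proof -
    have "?L r (b # nu) S * qK S ka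
      = (\<Sum>i\<in>S. \<Sum>m=0..b. cK (hlq_inv_coeff tt m) * ((1 - cK tt) * hlg (cK tt) XK S i * XK i ^ (r + m) * qK (S - {i}) nu
          * qK S ((b - m) # ka)))"
      unfolding sum_distrib_right
    proof (rule sum.cong[OF refl])
      fix i assume i: "i \<in> S"
      show "(1 - cK tt) * hlg (cK tt) XK S i * XK i ^ r * qK (S - {i}) (b # nu) * qK S ka
        = (\<Sum>m=0..b. cK (hlq_inv_coeff tt m) * ((1 - cK tt) * hlg (cK tt) XK S i * XK i ^ (r + m) * qK (S - {i}) nu
          * qK S ((b - m) # ka)))"
        unfolding hlqs_simps hlq_remove[OF S i] cK_hlq_inv_coeff sum_distrib_left sum_distrib_right
        by (intro sum.cong) (simp_all add: power_add mult_ac)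
    qed
    also have "\<dots> = (\<Sum>m=0..b. cK (hlq_inv_coeff tt m) * (?L (r + m) nu S * qK S ((b - m) # ka)))"
      by (subst sum.swap) (simp add: sum_distrib_left sum_distrib_right)
    also have "\<dots> = (\<Sum>m=0..b. cK (hlq_inv_coeff tt m) * (qK S ((r + m) # nu @ (b - m) # ka) + F m S))"
      using F(2)[OF S] by simp
    also have "\<dots> = qK S (r # (b # nu) @ ka) + G S"
      unfolding G_def by (subst sum.atLeast_Suc_atMost) (simp_all add: hlq_inv_coeff_def mult_ac)
    finally show ?thesis .
  qed
  ultimately show ?case unfolding U_def by blast
qed

text \<open>Apply the induction hypothesis in S - {i} and sum over i. By \<open>hlq_raise\<close>
  the main term becomes q_(a # mu) plus terms with a part larger than a. An error term q_nu becomes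
  q_(a # nu) plus such terms, and prefixing a preserves the strict comparison.\<close>

lemma hlR_expansion_aux:
  assumes "is_partition lam"
  shows "\<exists>F. qspan {sg. sum_list sg = sum_list lam \<and> pexp lam < pexp (pnorm sg)} F \<and>
    (\<forall>S. finite S \<longrightarrow> (1 - cK tt) ^ length lam * hlR (cK tt) XK S lam = qK S lam + F S)"
  using assms
proof (induction lam)
  case Nil
  show ?case by (intro exI[of _ "\<lambda>S. 0"]) (auto intro: qspan_zero)
next
  case (Cons a mu)
  define U where "U = {sg. sum_list sg = sum_list (a # mu) \<and> pexp (a # mu) < pexp (pnorm sg)}"
  let ?U = "{sg. sum_list sg = sum_list mu \<and> pexp mu < pexp (pnorm sg)}"
  let ?L = "\<lambda>F S. \<Sum>i\<in>S. (1 - cK tt) * hlg (cK tt) XK S i * XK i ^ a * F (S - {i})"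
  have a: "a \<ge> 1" and mu: "is_partition mu" using Cons.prems by (auto simp: is_partition_Cons)
  obtain F where F: "qspan ?U F"
    "\<And>S. finite S \<Longrightarrow> (1 - cK tt) ^ length mu * hlR (cK tt) XK S mu = qK S mu + F S"
    using Cons.IH[OF mu] by blast
  have raise: "\<exists>G. qspan U G \<and> (\<forall>S. finite S \<longrightarrow> ?L (\<lambda>S. qK S nu) S = qK S (a # nu) + G S)"
    if nu: "sum_list nu = sum_list mu" for nu
  proof -
    obtain G where G: "qspan {sg. sum_list sg = a + sum_list nu + sum_list [] \<and> (\<exists>b\<in>set sg. b > a)} G"
      "\<And>S. finite S \<Longrightarrow> ?L (\<lambda>S. qK S nu) S * qK S [] = qK S (a # nu @ []) + G S"
      using hlq_raise[OF a, of nu "[]"] by blast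
    have "qspan U G"
      by (rule qspan_mono[OF G(1)]) (use pexp_less_of_big_part nu in \<open>auto simp: U_def\<close>)
    then show ?thesis using G(2) by auto
  qed
  \<comment> \<open>\<open>?L\<close> is linear over the constants, so the error terms can be pushed
    through it one generator at a time.\<close>
  have "\<exists>H. qspan U H \<and> (\<forall>S. finite S \<longrightarrow> ?L F S = H S)"
    using F(1)
  proof (induction rule: qspan.induct)
    case qspan_zero
    then show ?case by (intro exI[of _ "\<lambda>S. 0"]) (auto intro: qspan.qspan_zero)
  next
    case (qspan_step F nu c)
    obtain H where H: "qspan U H" "\<And>S. finite S \<Longrightarrow> ?L F S = H S" using qspan_step by blast
    obtain G where G: "qspan U G" "\<And>S. finite S \<Longrightarrow> ?L (\<lambda>S. qK S nu) S = qK S (a # nu) + G S"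
      using raise[of nu] qspan_step.hyps by blast
    have "a # nu \<in> U" using qspan_step.hyps a pexp_less_pnorm_Cons[of mu nu a] by (auto simp: U_def)
    then have "qspan U (\<lambda>S. H S + cK c * (qK S (a # nu) + G S))"
      by (intro qspan_add qspan_scale qspan_single H G)
    moreover have "?L (\<lambda>S. F S + cK c * qK S nu) S = H S + cK c * (qK S (a # nu) + G S)" if "finite S" for S
      unfolding H(2)[OF that, symmetric] G(2)[OF that, symmetric]
      by (simp add: sum_distrib_left distrib_left sum.distrib mult_ac)
    ultimately show ?case by blast
  qed
  then obtain H where H: "qspan U H" "\<And>S. finite S \<Longrightarrow> ?L F S = H S" by blast
  obtain G where G: "qspan U G" "\<And>S. finite S \<Longrightarrow> ?L (\<lambda>S. qK S mu) S = qK S (a # mu) + G S"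
    using raise[of mu] by blast
  have "(1 - cK tt) ^ length (a # mu) * hlR (cK tt) XK S (a # mu) = qK S (a # mu) + (G S + H S)"
    if S: "finite S" for S
  proof -
    have "(1 - cK tt) ^ length (a # mu) * hlR (cK tt) XK S (a # mu)
      = ?L (\<lambda>S. (1 - cK tt) ^ length mu * hlR (cK tt) XK S mu) S"
      by (simp add: sum_distrib_left mult_ac)
    also have "\<dots> = ?L (\<lambda>S. qK S mu) S + ?L F S"
      using S by (simp add: F(2) distrib_left sum.distrib)
    finally show ?thesis using G(2)[OF S] H(2)[OF S] by simp
  qed
  moreover have "qspan U (\<lambda>S. G S + H S)" using G H by (intro qspan_add)
  ultimately show ?case unfolding U_def by blast
qed

text \<open>\<open>A\<close> is chosen before \<open>S\<close>: one matrix serves all numbers of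
  variables. All error indices lie strictly above \<open>lam\<close>, which leaves the diagonal
  place free for the main term.\<close>

lemma hlR_expansion:
  "\<exists>A. \<forall>d. \<forall>lam\<in>Parts d. A lam lam = (1 :: int poly) \<and>
     (\<forall>nu. A lam nu \<noteq> 0 \<longrightarrow> pexp lam \<le> pexp nu) \<and>
     (\<forall>S. finite S \<longrightarrow> (1 - cK tt) ^ length lam * hlR (cK tt) XK S lam = (\<Sum>nu\<in>Parts d. cK (A lam nu) * qK S nu))"
proof -
  have "\<exists>A. is_partition lam \<longrightarrow> A lam = (1 :: int poly) \<and>
     (\<forall>nu. A nu \<noteq> 0 \<longrightarrow> pexp lam \<le> pexp nu) \<and>
     (\<forall>S. finite S \<longrightarrow> (1 - cK tt) ^ length lam * hlR (cK tt) XK S lam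
        = (\<Sum>nu\<in>Parts (sum_list lam). cK (A nu) * qK S nu))" for lam
  proof (cases "is_partition lam")
    case True
    let ?U = "{sg. sum_list sg = sum_list lam \<and> pexp lam < pexp (pnorm sg)}"
    obtain F where F: "qspan ?U F"
      "\<And>S. finite S \<Longrightarrow> (1 - cK tt) ^ length lam * hlR (cK tt) XK S lam = qK S lam + F S"
      using hlR_expansion_aux[OF True] by blast
    obtain a where a: "\<And>nu. a nu \<noteq> 0 \<Longrightarrow> nu \<in> pnorm ` ?U"
      "\<And>d S. ?U \<subseteq> {nu. sum_list nu = d} \<Longrightarrow> F S = (\<Sum>nu\<in>Parts d. cK (a nu) * qK S nu)"
      using qspan_coeffs[OF F(1)] by meson
    have a0: "a lam = 0" using a(1)[of lam] by auto
    have aF: "F S = (\<Sum>nu\<in>Parts (sum_list lam). cK (a nu) * qK S nu)" for S by (rule a(2)) auto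
    have lam: "lam \<in> Parts (sum_list lam)" using True by (simp add: Parts_def)
    have "(\<Sum>nu\<in>Parts (sum_list lam). cK ((a(lam := 1)) nu) * qK S nu) = qK S lam + F S" for S
      unfolding aF by (simp add: sum.remove[OF _ lam] a0)
    moreover have "pexp lam \<le> pexp nu" if "(a(lam := 1)) nu \<noteq> 0" for nu
      using that a(1)[of nu] by (auto split: if_splits)
    ultimately show ?thesis using F(2) by (intro exI[of _ "a(lam := 1)"]) auto
  qed auto
  note ex = this
  have "\<exists>A. \<forall>lam. is_partition lam \<longrightarrow> A lam lam = (1 :: int poly) \<and>
     (\<forall>nu. A lam nu \<noteq> 0 \<longrightarrow> pexp lam \<le> pexp nu) \<and>
     (\<forall>S. finite S \<longrightarrow> (1 - cK tt) ^ length lam * hlR (cK tt) XK S lam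
        = (\<Sum>nu\<in>Parts (sum_list lam). cK (A lam nu) * qK S nu))"
    by (rule choice, rule allI, rule ex)
  then show ?thesis by (auto simp: Parts_def)
qed

section \<open>Leading terms\<close>

lemma tt_neq_1: "tt \<noteq> 1"
  by (simp add: tt_def one_pCons)

lemma geometric_tt: "(1 - tt) * (\<Sum>j<n. tt ^ j) = 1 - tt ^ n"
  by (simp add: one_diff_power_eq)

lemma vm_0 [simp]: "vm 0 = 1"
  by (simp add: vm_def)

lemma vm_Suc: "vm (Suc n) = vm n * (\<Sum>j\<le>n. tt ^ j)"
  by (simp add: vm_def lessThan_Suc_atMost)

lemma phim_eq: "phim n = (1 - tt) ^ n * vm n"
proof -
  have "phim n = (\<Prod>i=1..n. (1 - tt) * (\<Sum>j<i. tt ^ j))"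
    unfolding phim_def by (intro prod.cong refl) (simp add: geometric_tt)
  then show ?thesis by (simp add: prod.distrib vm_def)
qed

text \<open>At exponent 0 the correction term of the partial fractions takes part: 1 - t times the
  sum of the \<open>hlg\<close> is 1 - t^n, which gives one factor of v_n for each variable
  removed.\<close>

lemma hlR_zeros:
  assumes "finite S"
  shows "hlR (cK tt) XK S (replicate (card S) 0) = cK (vm (card S))"
  using assms
proof (induction "card S" arbitrary: S)
  case (Suc n)
  have "hlR (cK tt) XK S (0 # replicate n 0) = (\<Sum>i\<in>S. hlg (cK tt) XK S i * cK (vm n))"
  proof -
    have "hlR (cK tt) XK (S - {i}) (replicate n 0) = cK (vm n)" if "i \<in> S" for i
    proof -
      have c: "card (S - {i}) = n" using Suc.hyps(2) Suc.prems that by simp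
      show ?thesis using Suc.hyps(1)[OF c[symmetric]] Suc.prems unfolding c by simp
    qed
    then show ?thesis by simp
  qed
  also have "\<dots> = (\<Sum>i\<in>S. hlg (cK tt) XK S i) * cK (vm n)"
    by (simp add: sum_distrib_right)
  finally have *: "hlR (cK tt) XK S (0 # replicate n 0) = (\<Sum>i\<in>S. hlg (cK tt) XK S i) * cK (vm n)" .
  have "(1 - cK tt) * (\<Sum>i\<in>S. hlg (cK tt) XK S i) = 1 - cK tt ^ card S"
  proof -
    have "(\<Sum>i\<in>S. (1 - cK tt) * hlg (cK tt) XK S i * XK i ^ 0) = hlq (cK tt) XK S 0 - (if (0::nat) = 0 then cK tt ^ card S else 0)"
      using Suc.prems by (intro hlq_partial_fractions) (auto simp: inj_on_def inj_XK)
    then show ?thesis by (simp only: power_0 mult_1_right sum_distrib_left[symmetric] hlq_0 if_True refl)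
  qed
  also have "\<dots> = cK (1 - tt ^ card S)" by simp
  also have "\<dots> = cK ((1 - tt) * (\<Sum>j\<le>n. tt ^ j))"
    by (simp only: geometric_tt Suc.hyps(2)[symmetric] lessThan_Suc_atMost[symmetric])
  also have "\<dots> = (1 - cK tt) * cK (\<Sum>j\<le>n. tt ^ j)" by simp
  finally have "(\<Sum>i\<in>S. hlg (cK tt) XK S i) = cK (\<Sum>j\<le>n. tt ^ j)"
    using tt_neq_1 by (metis cK_hom(2,7) mult_cancel_left right_minus_eq)
  then show ?case
    using * by (simp add: Suc.hyps(2)[symmetric] vm_Suc mult.commute)
qed simp

text \<open>The padding zeros fall on the m variables left at the end, and their contribution v_m
  does not depend on which variables these are.\<close>

lemma hlR_append_zeros:
  assumes "finite S" "card S = length lam + m"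
  shows "hlR (cK tt) XK S (lam @ replicate m 0) = cK (vm m) * hlR (cK tt) XK S lam"
  using assms
proof (induction lam arbitrary: S)
  case Nil
  then show ?case using hlR_zeros[of S] by simp
next
  case (Cons a lam)
  have "hlR (cK tt) XK (S - {i}) (lam @ replicate m 0) = cK (vm m) * hlR (cK tt) XK (S - {i}) lam"
    if "i \<in> S" for i using Cons.IH[of "S - {i}"] Cons.prems that by simp
  then show ?case by (simp add: sum_distrib_left mult_ac)
qed

section \<open>Leading exponents of polynomials and rational functions\<close>

definition below :: "mpoly \<Rightarrow> (nat \<Rightarrow>\<^sub>0 nat) \<Rightarrow> bool" where
  "below p al \<longleftrightarrow> (\<forall>be\<in>Poly_Mapping.keys p. be < al)"

text \<open>Admitting \<open>c\<close> = 0 makes the relation additive at a fixed exponent, so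
  summands that stay below \<open>al\<close> fit in with coefficient 0.\<close>

definition leads :: "mpoly \<Rightarrow> (nat \<Rightarrow>\<^sub>0 nat) \<Rightarrow> int poly \<Rightarrow> bool" where
  "leads p al c \<longleftrightarrow> below (p - Poly_Mapping.single al c) al"

lemma below_0 [simp]: "below 0 al"
  by (simp add: below_def)

lemma below_add: "below p al \<Longrightarrow> below q al \<Longrightarrow> below (p + q) al"
  unfolding below_def using Poly_Mapping.keys_add[of p q] by blast

lemma add_less_pm:
  fixes a b c d :: "nat \<Rightarrow>\<^sub>0 nat"
  shows "a \<le> b \<Longrightarrow> c < d \<Longrightarrow> a + c < b + d"
  by (meson add_le_less_mono)

lemma below_mult:
  assumes "\<And>be. be \<in> Poly_Mapping.keys p \<Longrightarrow> be \<le> al" "below q al'"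
  shows "below (p * q) (al + al')"
proof -
  have "be < al + al'" if "be \<in> Poly_Mapping.keys (p * q)" for be
    using keys_mult[of p q] that assms unfolding below_def by (fastforce intro: add_less_pm)
  then show ?thesis by (simp add: below_def)
qed

lemma leads_single: "leads (Poly_Mapping.single al c) al c"
  by (simp add: leads_def)

lemma leads_add: "leads p al c \<Longrightarrow> leads q al d \<Longrightarrow> leads (p + q) al (c + d)"
  unfolding leads_def using below_add[of "p - Poly_Mapping.single al c" al "q - Poly_Mapping.single al d"]
  by (simp add: single_add algebra_simps)

lemma leads_mult:
  assumes "leads p al c" "leads q be d"
  shows "leads (p * q) (al + be) (c * d)"
proof -
  let ?s = "Poly_Mapping.single al c" and ?u = "Poly_Mapping.single be d"
  have p: "below (p - ?s) al" and q: "below (q - ?u) be" using assms by (auto simp: leads_def)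
  have "below ((p - ?s) * (q - ?u)) (al + be)"
    by (rule below_mult[OF _ q]) (use p in \<open>auto simp: below_def\<close>)
  moreover have "below (?s * (q - ?u)) (al + be)"
    by (rule below_mult[OF _ q]) (auto split: if_splits)
  moreover have "below (?u * (p - ?s)) (be + al)"
    by (rule below_mult[OF _ p]) (auto split: if_splits)
  ultimately have "below ((p - ?s) * (q - ?u) + ?s * (q - ?u) + ?u * (p - ?s)) (al + be)"
    by (intro below_add) (auto simp: add.commute)
  moreover have "(p - ?s) * (q - ?u) + ?s * (q - ?u) + ?u * (p - ?s) = p * q - Poly_Mapping.single (al + be) (c * d)"
    by (simp add: mult_single[symmetric] algebra_simps)
  ultimately show ?thesis by (simp add: leads_def)
qed

lemma leads_lookup: "leads p al c \<Longrightarrow> Poly_Mapping.lookup p al = c"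
proof (rule ccontr)
  assume "leads p al c" "Poly_Mapping.lookup p al \<noteq> c"
  then have "Poly_Mapping.lookup (p - Poly_Mapping.single al c) al \<noteq> 0"
    by (simp add: lookup_minus)
  then show False using \<open>leads p al c\<close>
    by (auto simp: leads_def below_def in_keys_iff)
qed

lemma leads_keys_le: "leads p al c \<Longrightarrow> Poly_Mapping.lookup p be \<noteq> 0 \<Longrightarrow> be \<le> al"
  by (cases "be = al") (auto simp: leads_def below_def in_keys_iff lookup_minus lookup_single less_imp_le)

lemma leads_weaken: "leads p al c \<Longrightarrow> al < be \<Longrightarrow> leads p be 0"
  unfolding leads_def[of p be] below_def using leads_keys_le[of p al c]
  by (auto simp: in_keys_iff intro: order.strict_trans1)

lemma leadsI:
  assumes "Poly_Mapping.lookup p al = c" "\<And>be. Poly_Mapping.lookup p be \<noteq> 0 \<Longrightarrow> be \<le> al"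
  shows "leads p al c"
  using assms unfolding leads_def below_def
  by (auto simp: in_keys_iff lookup_minus lookup_single when_def split: if_splits) (metis order_le_imp_less_or_eq)

text \<open>The leading exponent of a rational function is that of its numerator minus that of its (monic)
  denominator; the coefficient $c$ may be $0$.\<close>
definition leadsK :: "mpoly fract \<Rightarrow> (nat \<Rightarrow>\<^sub>0 nat) \<Rightarrow> int poly \<Rightarrow> bool" where
  "leadsK f al c \<longleftrightarrow> (\<exists>p q be. leads q be 1 \<and> leads p (al + be) c \<and> f * to_fract q = to_fract p)"

lemma leadsK_add:
  assumes "leadsK f al c" "leadsK g al d"
  shows "leadsK (f + g) al (c + d)"
proof -
  obtain p q be where 1: "leads q be 1" "leads p (al + be) c" "f * to_fract q = to_fract p"
    using assms(1) unfolding leadsK_def by blast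
  obtain p' q' be' where 2: "leads q' be' 1" "leads p' (al + be') d" "g * to_fract q' = to_fract p'"
    using assms(2) unfolding leadsK_def by blast
  have "leads (q * q') (be + be') (1 * 1)" by (intro leads_mult 1 2)
  moreover have "leads (p * q' + p' * q) (al + (be + be')) (c + d)"
  proof (rule leads_add)
    show "leads (p * q') (al + (be + be')) c"
      using leads_mult[OF 1(2) 2(1)] by (simp add: add.assoc)
    show "leads (p' * q) (al + (be + be')) d"
      using leads_mult[OF 2(2) 1(1)] by (simp add: add.assoc add.commute[of be be'])
  qed
  moreover have "(f + g) * to_fract (q * q') = to_fract (p * q' + p' * q)"
    by (simp add: 1(3)[symmetric] 2(3)[symmetric] algebra_simps)
  ultimately show ?thesis unfolding leadsK_def by (metis mult_1)
qed

lemma leadsK_mult: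
  assumes "leadsK f al c" "leadsK g al' d"
  shows "leadsK (f * g) (al + al') (c * d)"
proof -
  obtain p q be where 1: "leads q be 1" "leads p (al + be) c" "f * to_fract q = to_fract p"
    using assms(1) unfolding leadsK_def by blast
  obtain p' q' be' where 2: "leads q' be' 1" "leads p' (al' + be') d" "g * to_fract q' = to_fract p'"
    using assms(2) unfolding leadsK_def by blast
  have "leads (q * q') (be + be') (1 * 1)" by (intro leads_mult 1 2)
  moreover have "leads (p * p') ((al + al') + (be + be')) (c * d)"
    using leads_mult[OF 1(2) 2(2)] by (simp add: add_ac)
  moreover have "(f * g) * to_fract (q * q') = to_fract (p * p')"
    by (simp add: 1(3)[symmetric] 2(3)[symmetric] algebra_simps)
  ultimately show ?thesis unfolding leadsK_def by (metis mult_1)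
qed

lemma leads_one: "leads 1 0 1"
  unfolding single_one[symmetric] by (rule leads_single)

lemma leadsK_to_fract: "leads p al c \<Longrightarrow> leadsK (to_fract p) al c"
  unfolding leadsK_def by (intro exI[of _ p] exI[of _ 1] exI[of _ 0]) (auto simp: leads_one)

text \<open>If p q = r with q monic, the largest exponent of p plus that of q is the largest
  exponent of r, with the same coefficient as in p. Comparison with the bound known for r gives the
  bound for p.\<close>

lemma leadsK_to_fractD:
  assumes "leadsK (to_fract p) al c"
  shows "leads p al c"
proof -
  obtain r q be where 1: "leads q be 1" "leads r (al + be) c" "to_fract p * to_fract q = to_fract r"
    using assms(1) unfolding leadsK_def by blast
  then have r: "r = p * q" by (metis to_fract_eq_iff to_fract_mult)
  show ?thesis
  proof (cases "p = 0")
    case True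
    then have "c = 0" using 1(2) leads_lookup r by fastforce
    then show ?thesis using True by (simp add: leads_def)
  next
    case False
    define mu where "mu = Max (Poly_Mapping.keys p)"
    have ne: "Poly_Mapping.keys p \<noteq> {}" using False by simp
    have mu: "leads p mu (Poly_Mapping.lookup p mu)" "Poly_Mapping.lookup p mu \<noteq> 0"
      using Max_in[OF _ ne] by (auto simp: mu_def in_keys_iff intro!: leadsI Max_ge)
    have pq: "leads r (mu + be) (Poly_Mapping.lookup p mu)"
      using leads_mult[OF mu(1) 1(1)] r by simp
    then have "mu + be \<le> al + be"
      using leads_keys_le[OF 1(2)] leads_lookup mu(2) by metis
    then have le: "mu \<le> al" by (meson add_le_cancel_right linorder_not_le add_strict_right_mono)
    show ?thesis
    proof (cases "mu = al")
      case True
      then show ?thesis using mu(1) pq 1(2) leads_lookup by metis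
    next
      case False
      then have "mu < al" using le by simp
      then have "leads r (al + be) 0"
        using pq leads_weaken by (metis add_strict_right_mono)
      then have "c = 0" using 1(2) leads_lookup by metis
      then show ?thesis using leads_weaken[OF mu(1) \<open>mu < al\<close>] by simp
    qed
  qed
qed

lemma leadsK_one: "leadsK 1 0 1"
  using leadsK_to_fract[OF leads_one] by simp

lemma leadsK_zero: "leadsK 0 al 0"
  using leadsK_to_fract[of 0 al 0] by (simp add: leads_def)

lemma leadsK_cK: "leadsK (cK c) 0 c"
  unfolding cK_def Cst_def by (intro leadsK_to_fract leads_single)

lemma leadsK_weaken: "leadsK f al c \<Longrightarrow> al < be \<Longrightarrow> leadsK f be 0"
  unfolding leadsK_def by (meson add_strict_right_mono leads_weaken)

lemma leadsK_sum:
  assumes "\<And>i. i \<in> A \<Longrightarrow> leadsK (f i) al (c i)"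
  shows "leadsK (\<Sum>i\<in>A. f i) al (\<Sum>i\<in>A. c i)"
  using assms by (induction A rule: infinite_finite_induct) (auto intro: leadsK_zero leadsK_add)

lemma leadsK_prod_0:
  assumes "\<And>i. i \<in> A \<Longrightarrow> leadsK (f i) 0 (c i)"
  shows "leadsK (\<Prod>i\<in>A. f i) 0 (\<Prod>i\<in>A. c i)"
  using assms leadsK_mult[of _ 0 _ _ 0]
  by (induction A rule: infinite_finite_induct) (auto intro: leadsK_one)

lemma Xv_power: "Xv i ^ a = Poly_Mapping.single (Poly_Mapping.single i a) 1"
  by (induction a) (auto simp: Xv_def mult_single single_add[symmetric])

lemma leadsK_XK_power: "leadsK (XK i ^ a) (Poly_Mapping.single i a) 1"
proof -
  have "XK i ^ a = to_fract (Xv i ^ a)"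
    by (induction a) (auto simp: XK_def)
  then show ?thesis unfolding Xv_power by (simp add: leadsK_to_fract leads_single)
qed

lemma single_less_single: "i < j \<Longrightarrow> Poly_Mapping.single j (1::nat) < Poly_Mapping.single i 1"
  unfolding less_poly_mapping.rep_eq less_fun_def
  by (intro exI[of _ i]) (auto simp: lookup_single when_def)

text \<open>The variable of smaller index dominates. If it is x_i, numerator and denominator both
  start with 1; if it is x_j, they start with -t and -1, and both are negated to make the
  denominator monic.\<close>

lemma leadsK_factor:
  assumes "i \<noteq> j"
  shows "leadsK ((XK i - cK tt * XK j) / (XK i - XK j)) 0 (if i < j then 1 else tt)"
proof -
  let ?s = "\<lambda>i. Poly_Mapping.single i (1::nat)"
  have cX: "leads (Cst c * Xv i) (?s i) c" for i c
    unfolding Xv_def Cst_def by (simp add: mult_single leads_single)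
  have comb: "leads (Cst c * Xv i + Cst d * Xv j) (?s i) c" if "i < j" for i j c d
    using leads_add[OF cX[of c i] leads_weaken[OF cX[of d j] single_less_single[OF that]]] by simp
  have ne: "XK i - XK j \<noteq> 0" using assms by (simp add: inj_XK)
  show ?thesis
  proof (cases "i < j")
    case True
    have "leads (Xv i - Xv j) (?s i) 1" using comb[OF True, of 1 "-1"] by simp
    moreover have "leads (Xv i - Cst tt * Xv j) (0 + ?s i) 1" using comb[OF True, of 1 "-tt"] by simp
    moreover have "(XK i - cK tt * XK j) / (XK i - XK j) * to_fract (Xv i - Xv j) = to_fract (Xv i - Cst tt * Xv j)"
      using ne by (simp add: XK_def cK_def)
    ultimately have "leadsK ((XK i - cK tt * XK j) / (XK i - XK j)) 0 1"
      unfolding leadsK_def by blast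
    then show ?thesis using True by simp
  next
    case False
    then have ji: "j < i" using assms by simp
    have "leads (Xv j - Xv i) (?s j) 1" using comb[OF ji, of 1 "-1"] by simp
    moreover have "leads (Cst tt * Xv j - Xv i) (0 + ?s j) tt" using comb[OF ji, of tt "-1"] by simp
    moreover have "(XK i - cK tt * XK j) / (XK i - XK j) * to_fract (Xv j - Xv i) = to_fract (Cst tt * Xv j - Xv i)"
      using ne by (simp add: XK_def cK_def field_simps)
    ultimately have "leadsK ((XK i - cK tt * XK j) / (XK i - XK j)) 0 tt"
      unfolding leadsK_def by blast
    then show ?thesis using False by simp
  qed
qed

section \<open>The leading term of the symmetrised product\<close>

definition rank_in :: "nat set \<Rightarrow> nat \<Rightarrow> nat" where
  "rank_in S i = card {j\<in>S. j < i}"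

lemma leadsK_hlg:
  assumes "finite S" "i \<in> S"
  shows "leadsK (hlg (cK tt) XK S i) 0 (tt ^ rank_in S i)"
proof -
  have "leadsK (hlg (cK tt) XK S i) 0 (\<Prod>j\<in>S - {i}. if i < j then 1 else tt)"
    unfolding hlg_def by (rule leadsK_prod_0, rule leadsK_factor) auto
  also have "(\<Prod>j\<in>S - {i}. if i < j then 1 else tt) = (\<Prod>j\<in>{j\<in>S. j < i}. tt)"
    using assms(1) by (intro prod.mono_neutral_cong_right) auto
  finally show ?thesis by (simp add: rank_in_def)
qed

text \<open>The entries are handed to the elements of S in increasing order; for a weakly decreasing
  list this is the lexicographically largest assignment.\<close>

fun set_exp :: "nat set \<Rightarrow> nat list \<Rightarrow> (nat \<Rightarrow>\<^sub>0 nat)" where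
  "set_exp S [] = 0"
| "set_exp S (a # lam) = Poly_Mapping.single (Min S) a + set_exp (S - {Min S}) lam"

text \<open>Unlike \<open>is_partition\<close>, this admits the zeros used for padding.\<close>

definition desc :: "nat list \<Rightarrow> bool" where "desc lam \<longleftrightarrow> sorted_wrt (\<ge>) lam"

lemma desc_Cons [simp]: "desc (a # mu) \<longleftrightarrow> (\<forall>b\<in>set mu. b \<le> a) \<and> desc mu"
  by (auto simp: desc_def)

lemma lookup_set_exp_0:
  assumes "finite S" "j \<notin> S" "length mu \<le> card S"
  shows "Poly_Mapping.lookup (set_exp S mu) j = 0"
  using assms
proof (induction mu arbitrary: S)
  case (Cons a mu)
  have "S \<noteq> {}" using Cons.prems by auto
  then have "Min S \<in> S" using Cons.prems by auto
  then have "Min S \<noteq> j" using Cons.prems by auto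
  moreover have "Poly_Mapping.lookup (set_exp (S - {Min S}) mu) j = 0"
    using Cons.prems \<open>Min S \<in> S\<close> by (intro Cons.IH) auto
  ultimately show ?case by (simp add: lookup_add lookup_single)
qed simp

text \<open>Here \<open>i\<close> receives the largest entry \<open>a\<close> in place of
  \<open>Min S\<close>. The elements of S before \<open>i\<close> then receive the first entries of
  \<open>mu\<close>, so the exponent is unchanged exactly when all of these equal
  \<open>a\<close>.\<close>

lemma set_exp_exchange:
  assumes "finite S" "i \<in> S" "desc (a # mu)" "Suc (length mu) = card S"
  shows "if rank_in S i \<le> count_list mu a
    then Poly_Mapping.single i a + set_exp (S - {i}) mu = set_exp S (a # mu)
    else Poly_Mapping.single i a + set_exp (S - {i}) mu < set_exp S (a # mu)"
  using assms
proof (induction mu arbitrary: S)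
  case Nil
  then have "S = {i}" using card_1_singletonE[of S] by auto
  then show ?case by (simp add: rank_in_def)
next
  case (Cons b mu)
  define s where "s = Min S"
  have sS: "s \<in> S" "\<And>j. j \<in> S \<Longrightarrow> s \<le> j"
    unfolding s_def using Cons.prems(1,2) by (intro Min_in, auto)
  show ?case
  proof (cases "i = s")
    case True
    then have "{j\<in>S. j < i} = {}" using sS(2) by force
    then have "rank_in S i = 0" unfolding rank_in_def by simp
    then show ?thesis using True by (simp add: s_def)
  next
    case False
    have si: "s < i" using False sS(2) Cons.prems(2) by (simp add: order.not_eq_order_implies_strict)
    have Min2: "Min (S - {i}) = s"
      using Cons.prems(1) sS False by (intro Min_eqI) auto
    have swap: "S - {i} - {s} = S - {s} - {i}" by auto
    have "{j\<in>S. j < i} = insert s {j\<in>S - {s}. j < i}" using sS si by auto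
    then have rank: "rank_in S i = Suc (rank_in (S - {s}) i)"
      using Cons.prems(1) by (simp add: rank_in_def)
    show ?thesis
    proof (cases "b = a")
      case True
      have IH: "if rank_in (S - {s}) i \<le> count_list mu a
        then Poly_Mapping.single i a + set_exp (S - {s} - {i}) mu = set_exp (S - {s}) (a # mu)
        else Poly_Mapping.single i a + set_exp (S - {s} - {i}) mu < set_exp (S - {s}) (a # mu)"
        using Cons.prems False sS(1) True by (intro Cons.IH) auto
      have L: "Poly_Mapping.single i a + set_exp (S - {i}) (b # mu)
        = Poly_Mapping.single s a + (Poly_Mapping.single i a + set_exp (S - {s} - {i}) mu)"
        by (simp only: set_exp.simps Min2 swap True add_ac)
      have R: "set_exp S (a # b # mu) = Poly_Mapping.single s a + set_exp (S - {s}) (a # mu)"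
        using True by (simp add: s_def)
      show ?thesis unfolding L R rank using IH True
        by (auto split: if_splits intro: add_strict_left_mono)
    next
      case False
      then have ba: "b < a" using Cons.prems(3) by auto
      have "set mu \<subseteq> {..b}" using Cons.prems(3) by auto
      then have "count_list (b # mu) a = 0" using ba by (auto simp: count_list_0_iff)
      \<comment> \<open>The smallest element \<open>s\<close> receives b < a instead of a, and no
        smaller index occurs on either side.\<close>
      moreover have "Poly_Mapping.single i a + set_exp (S - {i}) (b # mu) < set_exp S (a # b # mu)"
        unfolding less_poly_mapping.rep_eq less_fun_def
      proof (intro exI[of _ s] conjI allI impI)
        have l: "Poly_Mapping.lookup (set_exp (S - {s} - {i}) mu) j = 0"
          "Poly_Mapping.lookup (set_exp (S - {s}) (b # mu)) j = 0" if "j \<le> s" for j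
          using Cons.prems sS \<open>i \<noteq> s\<close> that by (intro lookup_set_exp_0; force)+
        have L: "Poly_Mapping.single i a + set_exp (S - {i}) (b # mu)
          = Poly_Mapping.single i a + (Poly_Mapping.single s b + set_exp (S - {s} - {i}) mu)"
          by (simp only: set_exp.simps Min2 swap)
        have R: "set_exp S (a # b # mu) = Poly_Mapping.single s a + set_exp (S - {s}) (b # mu)"
          by (simp add: s_def)
        show "Poly_Mapping.lookup (Poly_Mapping.single i a + set_exp (S - {i}) (b # mu)) s
          < Poly_Mapping.lookup (set_exp S (a # b # mu)) s"
          unfolding L R using l[of s] si ba by (simp only: lookup_add lookup_single) simp
        fix j assume "j < s"
        then show "Poly_Mapping.lookup (Poly_Mapping.single i a + set_exp (S - {i}) (b # mu)) j
          = Poly_Mapping.lookup (set_exp S (a # b # mu)) j"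
          unfolding L R using l[of j] si by (simp only: lookup_add lookup_single) simp
      qed
      ultimately show ?thesis using rank by simp
    qed
  qed
qed

lemma rank_in_bij:
  assumes "finite S"
  shows "bij_betw (rank_in S) S {..<card S}"
proof -
  have mono: "rank_in S i < rank_in S j" if "i \<in> S" "i < j" for i j
    unfolding rank_in_def using assms that by (intro psubset_card_mono) auto
  have inj: "inj_on (rank_in S) S"
    by (rule inj_onI) (metis mono less_irrefl linorder_neq_iff)
  have "rank_in S i < card S" if "i \<in> S" for i
    unfolding rank_in_def using assms that by (intro psubset_card_mono) auto
  then have "rank_in S ` S \<subseteq> {..<card S}" by auto
  then have "rank_in S ` S = {..<card S}"
    by (rule card_subset_eq[rotated]) (auto simp: card_image[OF inj])
  then show ?thesis using inj by (simp add: bij_betw_def)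
qed

text \<open>Each entry counts, with weight t^rank, the variables that can receive it without
  lowering the top exponent; a run of m equal entries yields v_m in total.\<close>

fun run_coeff :: "nat list \<Rightarrow> int poly" where
  "run_coeff [] = 1"
| "run_coeff (a # mu) = (\<Sum>k\<le>count_list mu a. tt ^ k) * run_coeff mu"

text \<open>Only elements of rank at most \<open>count_list mu a\<close> reach the top exponent,
  each with coefficient t^rank; the other summands are weakened to coefficient 0. As i runs through
  S, the rank takes each value below \<open>card S\<close> once, which leaves a geometric
  sum.\<close>

lemma leadsK_hlR:
  assumes "finite S" "desc lam" "length lam = card S"
  shows "leadsK (hlR (cK tt) XK S lam) (set_exp S lam) (run_coeff lam)"
  using assms
proof (induction lam arbitrary: S)
  case Nil
  then show ?case by (simp add: leadsK_one)
next
  case (Cons a mu)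
  let ?c = "\<lambda>i. if rank_in S i \<le> count_list mu a then tt ^ rank_in S i * run_coeff mu else 0"
  have "leadsK (hlR (cK tt) XK S (a # mu)) (set_exp S (a # mu)) (\<Sum>i\<in>S. ?c i)"
    unfolding hlR.simps
  proof (rule leadsK_sum)
    fix i assume i: "i \<in> S"
    have "leadsK (hlR (cK tt) XK (S - {i}) mu) (set_exp (S - {i}) mu) (run_coeff mu)"
      using Cons.prems i by (intro Cons.IH) auto
    then have lk: "leadsK (hlg (cK tt) XK S i * XK i ^ a * hlR (cK tt) XK (S - {i}) mu)
      (0 + Poly_Mapping.single i a + set_exp (S - {i}) mu) (tt ^ rank_in S i * 1 * run_coeff mu)"
      by (intro leadsK_mult leadsK_hlg leadsK_XK_power Cons.prems i)
    have ex: "if rank_in S i \<le> count_list mu a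
      then Poly_Mapping.single i a + set_exp (S - {i}) mu = set_exp S (a # mu)
      else Poly_Mapping.single i a + set_exp (S - {i}) mu < set_exp S (a # mu)"
      using Cons.prems i by (intro set_exp_exchange) auto
    show "leadsK (hlg (cK tt) XK S i * XK i ^ a * hlR (cK tt) XK (S - {i}) mu) (set_exp S (a # mu)) (?c i)"
    proof (cases "rank_in S i \<le> count_list mu a")
      case True
      then show ?thesis using lk ex by (simp only: if_True add_0 mult_1_right)
    next
      case False
      then show ?thesis using leadsK_weaken[OF lk] ex by (simp only: if_False add_0)
    qed
  qed
  also have "(\<Sum>i\<in>S. ?c i) = (\<Sum>k<card S. if k \<le> count_list mu a then tt ^ k * run_coeff mu else 0)"
    by (rule sum.reindex_bij_betw[OF rank_in_bij[OF Cons.prems(1)]])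
  also have "\<dots> = (\<Sum>k\<le>count_list mu a. tt ^ k * run_coeff mu)"
    using Cons.prems(3) count_le_length[of mu a] by (intro sum.mono_neutral_cong_right) auto
  finally show ?case by (simp add: sum_distrib_right)
qed

lemma run_coeff_eq:
  assumes "desc lam" "\<And>b. b \<in> set lam \<Longrightarrow> b \<le> M"
  shows "run_coeff lam = (\<Prod>i\<in>{0..M}. vm (count_list lam i))"
  using assms
proof (induction lam)
  case (Cons a mu)
  have a: "a \<in> {0..M}" using Cons.prems by auto
  have "(\<Prod>i\<in>{0..M}. vm (count_list (a # mu) i))
    = vm (Suc (count_list mu a)) * (\<Prod>i\<in>{0..M} - {a}. vm (count_list mu i))"
    using a by (subst prod.remove[OF _ a]) (auto intro!: prod.cong)
  also have "\<dots> = (\<Sum>k\<le>count_list mu a. tt ^ k) * (\<Prod>i\<in>{0..M}. vm (count_list mu i))"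
    using a by (subst prod.remove[OF _ a, of "\<lambda>i. vm (count_list mu i)"]) (auto simp: vm_Suc mult_ac)
  finally show ?case using Cons by simp
qed simp

section \<open>The constants v_lambda and b_lambda\<close>

lemma card_part_eq_count_list:
  "length lam \<le> n \<Longrightarrow> pmult n lam i = count_list (lam @ replicate (n - length lam) 0) i"
proof -
  assume l: "length lam \<le> n"
  let ?L = "lam @ replicate (n - length lam) 0"
  have "part lam k = ?L ! k" if "k < n" for k
    using that l by (auto simp: part_def nth_append)
  then have "{k. k < n \<and> part lam k = i} = {k. k < length ?L \<and> i = ?L ! k}" using l by auto
  then show ?thesis by (simp only: pmult_def count_list_eq_length_filter length_filter_conv_card)
qed

lemma partition_bounds:
  assumes "is_partition lam"
  shows "b \<in> set lam \<Longrightarrow> b \<le> (if lam = [] then 0 else hd lam)"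
    and "desc (lam @ replicate m 0)" and "0 \<notin> set lam"
proof -
  have "sorted_wrt (\<ge>) (replicate m (0::nat))" by (induction m) auto
  then show "desc (lam @ replicate m 0)"
    using assms by (auto simp: is_partition_def desc_def sorted_wrt_append)
  show "b \<in> set lam \<Longrightarrow> b \<le> (if lam = [] then 0 else hd lam)"
    using assms by (cases lam) (auto simp: is_partition_def)
  show "0 \<notin> set lam" using assms by (simp add: is_partition_def)
qed

lemma vlam_eq_run_coeff:
  assumes "is_partition lam" "length lam \<le> n"
  shows "vlam n lam = run_coeff (lam @ replicate (n - length lam) 0)"
  unfolding vlam_def card_part_eq_count_list[OF assms(2)]
  using partition_bounds[OF assms(1)] by (intro run_coeff_eq[symmetric]) (auto split: if_splits)

text \<open>For each positive part size phi_m = (1 - t)^m v_m; in addition v_lambda contains the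
  factor of the n - \<open>length lam\<close> zeros. The product form avoids division in
  Z[t].\<close>

lemma blam_vlam:
  assumes "is_partition lam" "length lam \<le> n"
  shows "blam lam * vm (n - length lam) = (1 - tt) ^ length lam * vlam n lam"
proof -
  define M where "M = (if lam = [] then 0 else hd lam)"
  have b: "blam lam = (\<Prod>i\<in>{1..M}. phim (count_list lam i))"
    unfolding blam_def M_def by (simp add: card_part_eq_count_list)
  have v: "vlam n lam = vm (n - length lam) * (\<Prod>i\<in>{1..M}. vm (count_list lam i))"
  proof -
    have "vlam n lam = (\<Prod>i\<in>{0..M}. vm (count_list (lam @ replicate (n - length lam) 0) i))"
      unfolding vlam_def M_def card_part_eq_count_list[OF assms(2)] ..
    also have "\<dots> = vm (count_list (lam @ replicate (n - length lam) 0) 0)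
       * (\<Prod>i\<in>{1..M}. vm (count_list (lam @ replicate (n - length lam) 0) i))"
      by (subst prod.atLeast_Suc_atMost) auto
    also have "count_list (lam @ replicate (n - length lam) 0) 0 = n - length lam"
      using partition_bounds(3)[OF assms(1)] by (auto simp: count_list_eq_length_filter filter_empty_conv intro!: Nat.gr0I)
    also have "(\<Prod>i\<in>{1..M}. vm (count_list (lam @ replicate (n - length lam) 0) i)) = (\<Prod>i\<in>{1..M}. vm (count_list lam i))"
      by (intro prod.cong refl) (auto simp: count_list_eq_length_filter)
    finally show ?thesis .
  qed
  have "(\<Sum>i\<in>{1..M}. count_list lam i) = length lam"
  proof -
    have "set lam \<subseteq> {1..M}"
      using partition_bounds(1,3)[OF assms(1)] unfolding M_def by (auto simp: Suc_le_eq intro!: Nat.gr0I)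
    then have "(\<Sum>i\<in>{1..M}. count_list lam i) = (\<Sum>i\<in>set lam. count_list lam i)"
      by (intro sum.mono_neutral_right) (auto simp: count_list_0_iff)
    then show ?thesis by (simp add: sum_count_set)
  qed
  then have "(\<Prod>i\<in>{1..M}. (1 - tt) ^ count_list lam i) = (1 - tt) ^ length lam"
    by (simp add: power_sum[symmetric])
  then show ?thesis unfolding b v phim_eq prod.distrib by simp
qed

section \<open>Symmetrisation over permutations and over lists\<close>

definition lt_pairs :: "nat \<Rightarrow> (nat \<times> nat) set" where
  "lt_pairs n = {(i, j). i < j \<and> j < n}"

lemma finite_lt_pairs [simp]: "finite (lt_pairs n)"
  by (rule finite_subset[of _ "{..<n} \<times> {..<n}"]) (auto simp: lt_pairs_def)

lemma lt_pairs_Suc: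
  "lt_pairs (Suc n) = (\<lambda>j. (0, Suc j)) ` {..<n} \<union> (\<lambda>(i, j). (Suc i, Suc j)) ` lt_pairs n"
proof (intro equalityI subsetI)
  fix p assume "p \<in> lt_pairs (Suc n)"
  then obtain i j where p: "p = (i, j)" "i < j" "j < Suc n" by (auto simp: lt_pairs_def)
  then obtain j' where "j = Suc j'" by (cases j) auto
  then show "p \<in> (\<lambda>j. (0, Suc j)) ` {..<n} \<union> (\<lambda>(i, j). (Suc i, Suc j)) ` lt_pairs n"
    using p by (cases i) (auto simp: lt_pairs_def image_iff)
qed (auto simp: lt_pairs_def)

lemma prod_lt_pairs_Suc:
  fixes f :: "nat \<Rightarrow> nat \<Rightarrow> 'a::comm_monoid_mult"
  shows "(\<Prod>(i,j)\<in>lt_pairs (Suc n). f i j) = (\<Prod>j<n. f 0 (Suc j)) * (\<Prod>(i,j)\<in>lt_pairs n. f (Suc i) (Suc j))"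
proof -
  have "(\<Prod>(i,j)\<in>lt_pairs (Suc n). f i j) = (\<Prod>(i,j)\<in>(\<lambda>j. (0, Suc j)) ` {..<n}. f i j)
    * (\<Prod>(i,j)\<in>(\<lambda>(i, j). (Suc i, Suc j)) ` lt_pairs n. f i j)"
    unfolding lt_pairs_Suc by (rule prod.union_disjoint) auto
  also have "(\<Prod>(i,j)\<in>(\<lambda>j. (0, Suc j)) ` {..<n}. f i j) = (\<Prod>j<n. f 0 (Suc j))"
    by (subst prod.reindex) (auto simp: inj_on_def)
  also have "(\<Prod>(i,j)\<in>(\<lambda>(i, j). (Suc i, Suc j)) ` lt_pairs n. f i j) = (\<Prod>(i,j)\<in>lt_pairs n. f (Suc i) (Suc j))"
    by (subst prod.reindex) (auto simp: inj_on_def case_prod_beta)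
  finally show ?thesis .
qed

lemma inversions_transpose:
  assumes "a < b" "b < n"
  shows "{(i, j). (i, j) \<in> lt_pairs n \<and> transpose a b j < transpose a b i}
    = insert (a, b) ((\<lambda>k. (a, k)) ` {a<..<b} \<union> (\<lambda>k. (k, b)) ` {a<..<b})"
  using assms by (auto simp: lt_pairs_def transpose_def split: if_splits)

lemma odd_card_inversions_transpose:
  assumes "a < b" "b < n"
  shows "odd (card {(i, j). (i, j) \<in> lt_pairs n \<and> transpose a b j < transpose a b i})"
proof -
  have "card ((\<lambda>k. (a, k)) ` {a<..<b} \<union> (\<lambda>k. (k, b)) ` {a<..<b}) = (b - Suc a) + (b - Suc a)"
    by (subst card_Un_disjoint) (auto simp: card_image inj_on_def)
  moreover have "(a, b) \<notin> (\<lambda>k. (a, k)) ` {a<..<b} \<union> (\<lambda>k. (k, b)) ` {a<..<b}" by auto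
  ultimately show ?thesis unfolding inversions_transpose[OF assms] by simp
qed

text \<open>A transposition permutes the unordered index pairs and flips the sign of a factor at
  each inversion; for a < b there are 2 (b - a - 1) + 1 inversions.\<close>

lemma difference_prod_transpose:
  fixes y :: "nat \<Rightarrow> 'a::comm_ring_1"
  assumes "a < n" "b < n" "a \<noteq> b"
  shows "(\<Prod>(i,j)\<in>lt_pairs n. y (transpose a b i) - y (transpose a b j)) = - (\<Prod>(i,j)\<in>lt_pairs n. y i - y j)"
proof -
  have *: "(\<Prod>(i,j)\<in>lt_pairs n. y (transpose a b i) - y (transpose a b j)) = - (\<Prod>(i,j)\<in>lt_pairs n. y i - y j)"
    if ab: "a < b" "b < n" for a b
  proof -
    define tau where "tau = transpose a b"
    define phi where "phi = (\<lambda>(i, j). if tau i < tau j then (tau i, tau j) else (tau j, tau i))"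
    define eps where "eps = (\<lambda>(i, j). if tau j < tau i then - 1 else (1 :: 'a))"
    have tau: "tau (tau i) = i" "tau i = tau j \<longleftrightarrow> i = j" "i < n \<Longrightarrow> tau i < n" for i j
      using ab by (auto simp: tau_def) (auto simp: transpose_def split: if_splits)
    have phi: "phi p \<in> lt_pairs n" "phi (phi p) = p" if "p \<in> lt_pairs n" for p
      using that tau by (auto simp: lt_pairs_def phi_def not_less le_less split: if_splits)
    have "(\<Prod>(i,j)\<in>lt_pairs n. y (tau i) - y (tau j)) = (\<Prod>p\<in>lt_pairs n. eps p * (case phi p of (i, j) \<Rightarrow> y i - y j))"
      by (intro prod.cong refl) (use tau in \<open>auto simp: lt_pairs_def eps_def phi_def\<close>)
    also have "\<dots> = (\<Prod>p\<in>lt_pairs n. eps p) * (\<Prod>p\<in>lt_pairs n. case phi p of (i, j) \<Rightarrow> y i - y j)"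
      by (rule prod.distrib)
    also have "(\<Prod>p\<in>lt_pairs n. case phi p of (i, j) \<Rightarrow> y i - y j) = (\<Prod>(i,j)\<in>lt_pairs n. y i - y j)"
      by (rule prod.reindex_bij_witness[of _ phi phi]) (use phi in auto)
    also have "(\<Prod>p\<in>lt_pairs n. eps p) = (\<Prod>p\<in>{(i, j). (i, j) \<in> lt_pairs n \<and> tau j < tau i}. - 1)"
      by (rule prod.mono_neutral_cong_right) (auto simp: eps_def split: if_splits)
    also have "\<dots> = - 1"
      using odd_card_inversions_transpose[OF ab] by (simp add: tau_def)
    finally show ?thesis by (simp add: tau_def)
  qed
  show ?thesis
    using *[of a b] *[of b a] assms by (cases a b rule: linorder_cases) (auto simp: transpose_commute)
qed

lemma difference_prod_permutes:
  fixes y :: "nat \<Rightarrow> 'a::comm_ring_1"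
  assumes "w permutes {..<n}"
  shows "(\<Prod>(i,j)\<in>lt_pairs n. y (w i) - y (w j)) = of_int (sign w) * (\<Prod>(i,j)\<in>lt_pairs n. y i - y j)"
  using assms finite_lessThan
proof (induction arbitrary: y rule: permutes_induct)
  case id
  then show ?case by simp
next
  case (swap a b p)
  have "(\<Prod>(i,j)\<in>lt_pairs n. y ((transpose a b \<circ> p) i) - y ((transpose a b \<circ> p) j))
    = of_int (sign p) * (\<Prod>(i,j)\<in>lt_pairs n. y (transpose a b i) - y (transpose a b j))"
    using swap.IH[of "y \<circ> transpose a b"] by simp
  also have "\<dots> = of_int (- sign p) * (\<Prod>(i,j)\<in>lt_pairs n. y i - y j)"
    using swap.hyps by (subst difference_prod_transpose) auto
  also have "- sign p = sign (transpose a b \<circ> p)"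
    using swap.hyps permutes_imp_permutation[of "{..<n}" p]
    by (simp add: sign_compose sign_swap_id permutation_swap_id)
  finally show ?case .
qed

text \<open>One summand of the symmetrisation, for the permutation with value list
  \<open>xs\<close>. Grouping factors by their first index prepares the recursion of
  \<open>hlR\<close>; for lists of equal length the default 1 is reached only at the end.\<close>

fun hl_term :: "'a::field \<Rightarrow> (nat \<Rightarrow> 'a) \<Rightarrow> nat list \<Rightarrow> nat list \<Rightarrow> 'a" where
  "hl_term t x (i # xs) (a # lam) =
     x i ^ a * prod_list (map (\<lambda>j. (x i - t * x j) / (x i - x j)) xs) * hl_term t x xs lam"
| "hl_term t x _ _ = 1"

lemma hl_term_eq:
  assumes "length xs = length lam"
  shows "hl_term t x xs lam = (\<Prod>i<length xs. x (xs ! i) ^ (lam ! i)) *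
    (\<Prod>(i,j)\<in>lt_pairs (length xs). (x (xs ! i) - t * x (xs ! j)) / (x (xs ! i) - x (xs ! j)))"
  using assms
proof (induction xs lam rule: list_induct2)
  case Nil
  then show ?case by (simp add: lt_pairs_def)
next
  case (Cons i xs a lam)
  have "prod_list (map f xs) = (\<Prod>j<length xs. f (xs ! j))" for f :: "nat \<Rightarrow> 'a" and xs
    by (induction xs) (simp_all add: prod.lessThan_Suc_shift del: prod.lessThan_Suc)
  then show ?case
    by (simp add: Cons.IH prod_lt_pairs_Suc prod.lessThan_Suc_shift mult_ac del: prod.lessThan_Suc)
qed

text \<open>Group the permutations by their first entry i: the product over the later entries
  depends only on the set S - {i}, so it is the common factor \<open>hlg t x S i\<close>.\<close>

lemma sum_hl_term:
  assumes "finite S" "length lam = card S"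
  shows "(\<Sum>xs\<in>permutations_of_set S. hl_term t x xs lam) = hlR t x S lam"
  using assms
proof (induction lam arbitrary: S)
  case Nil
  then show ?case by simp
next
  case (Cons a lam)
  have ne: "S \<noteq> {}" using Cons.prems by auto
  have "(\<Sum>xs\<in>permutations_of_set S. hl_term t x xs (a # lam))
    = (\<Sum>i\<in>S. \<Sum>xs\<in>(#) i ` permutations_of_set (S - {i}). hl_term t x xs (a # lam))"
    unfolding permutations_of_set_nonempty[OF ne]
    using Cons.prems by (intro sum.UNION_disjoint) auto
  also have "\<dots> = (\<Sum>i\<in>S. hlg t x S i * x i ^ a * hlR t x (S - {i}) lam)"
  proof (rule sum.cong[OF refl])
    fix i assume i: "i \<in> S"
    have "(\<Sum>xs\<in>(#) i ` permutations_of_set (S - {i}). hl_term t x xs (a # lam))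
      = (\<Sum>xs\<in>permutations_of_set (S - {i}). hl_term t x (i # xs) (a # lam))"
      by (subst sum.reindex) auto
    also have "\<dots> = (\<Sum>xs\<in>permutations_of_set (S - {i}). hlg t x S i * x i ^ a * hl_term t x xs lam)"
    proof (rule sum.cong[OF refl])
      fix xs assume "xs \<in> permutations_of_set (S - {i})"
      then have xs: "distinct xs" "set xs = S - {i}" by (auto simp: permutations_of_set_def)
      have "prod_list (map (\<lambda>j. (x i - t * x j) / (x i - x j)) xs) = hlg t x S i"
        unfolding hlg_def xs(2)[symmetric] using xs(1) by (simp add: prod.distinct_set_conv_list)
      then show "hl_term t x (i # xs) (a # lam) = hlg t x S i * x i ^ a * hl_term t x xs lam"
        by (simp add: mult_ac)
    qed
    also have "\<dots> = hlg t x S i * x i ^ a * hlR t x (S - {i}) lam"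
      using Cons.IH[of "S - {i}"] Cons.prems i by (simp add: sum_distrib_left[symmetric])
    finally show "(\<Sum>xs\<in>(#) i ` permutations_of_set (S - {i}). hl_term t x xs (a # lam))
      = hlg t x S i * x i ^ a * hlR t x (S - {i}) lam" .
  qed
  finally show ?case by simp
qed

lemma bij_betw_permutes_lists:
  "bij_betw (\<lambda>w. map w [0..<n]) {w. w permutes {..<n}} (permutations_of_set {..<n})"
proof -
  have inj: "inj_on (\<lambda>w. map w [0..<n]) {w. w permutes {..<n}}"
  proof (rule inj_onI)
    fix v w assume v: "v \<in> {w. w permutes {..<n}}" and w: "w \<in> {w. w permutes {..<n}}"
      and eq: "map v [0..<n] = map w [0..<n]"
    show "v = w"
    proof
      fix i
      show "v i = w i"
        using eq v w by (cases "i < n") (auto simp: permutes_def)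
    qed
  qed
  have sub: "(\<lambda>w. map w [0..<n]) ` {w. w permutes {..<n}} \<subseteq> permutations_of_set {..<n}"
    by (auto simp: permutations_of_set_def permutes_image atLeast0LessThan distinct_map
        intro: permutes_inj_on)
  have "card ((\<lambda>w. map w [0..<n]) ` {w. w permutes {..<n}}) = card (permutations_of_set {..<n})"
    by (simp add: card_image[OF inj] card_permutations)
  then have "(\<lambda>w. map w [0..<n]) ` {w. w permutes {..<n}} = permutations_of_set {..<n}"
    using sub by (intro card_subset_eq) auto
  then show ?thesis using inj by (simp add: bij_betw_def)
qed

lemma to_fract_sum: "to_fract (sum f A) = (\<Sum>i\<in>A. to_fract (f i))"
  by (induction A rule: infinite_finite_induct) auto

lemma to_fract_prod: "to_fract (prod f A) = (\<Prod>i\<in>A. to_fract (f i))"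
  by (induction A rule: infinite_finite_induct) auto

lemma to_fract_power: "to_fract (a ^ n) = to_fract a ^ n"
  by (induction n) auto

lemma to_fract_sign: "to_fract (of_int (sign w)) = of_int (sign w)"
  by (cases w rule: sign_cases) auto

lemma vandermonde_nonzero: "vandermonde n \<noteq> 0"
proof
  assume "vandermonde n = 0"
  then obtain i j where "i < j" "Xv i - Xv j = 0"
    using finite_lt_pairs[of n] by (auto simp: vandermonde_def lt_pairs_def prod_zero_iff)
  then have "XK i = XK j" by (simp add: XK_def)
  then show False using \<open>i < j\<close> by (simp add: inj_XK)
qed

text \<open>Permuting the variables multiplies the Vandermonde product by the sign, so the sign in
  each summand is absorbed when the permuted differences become denominators.\<close>

lemma antisymHL_eq_hlR:
  assumes "length lam \<le> n"
  shows "to_fract (antisymHL n lam) = to_fract (vandermonde n) * hlR (cK tt) XK {..<n} (lam @ replicate (n - length lam) 0)"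
proof -
  let ?L = "lam @ replicate (n - length lam) 0"
  let ?P = "{w. w permutes {..<n}}"
  have V: "to_fract (vandermonde n) = (\<Prod>(i,j)\<in>lt_pairs n. XK i - XK j)"
    by (simp add: vandermonde_def lt_pairs_def to_fract_prod case_prod_beta XK_def)
  have L: "part lam i = ?L ! i" if "i < n" for i
    using that assms by (auto simp: part_def nth_append)
  have "to_fract (antisymHL n lam) = (\<Sum>w\<in>?P. of_int (sign w) * (\<Prod>i<n. XK (w i) ^ (?L ! i))
      * (\<Prod>(i,j)\<in>lt_pairs n. XK (w i) - cK tt * XK (w j)))"
    unfolding antisymHL_def
    by (simp add: to_fract_sum to_fract_prod to_fract_power to_fract_sign case_prod_beta lt_pairs_def XK_def cK_def L)
  also have "\<dots> = (\<Sum>w\<in>?P. to_fract (vandermonde n) * hl_term (cK tt) XK (map w [0..<n]) ?L)"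
  proof (rule sum.cong[OF refl])
    fix w assume "w \<in> ?P"
    then have w: "w permutes {..<n}" by simp
    have wj: "w i \<noteq> w j" if "i < j" for i j
      using permutes_inj[OF w] that by (auto simp: inj_def)
    define N where "N = (\<Prod>(i,j)\<in>lt_pairs n. XK (w i) - cK tt * XK (w j))"
    define D where "D = (\<Prod>(i,j)\<in>lt_pairs n. XK (w i) - XK (w j))"
    have D: "D = of_int (sign w) * to_fract (vandermonde n)"
      unfolding D_def V by (rule difference_prod_permutes[OF w])
    have D0: "D \<noteq> 0" unfolding D_def prod_zero_iff[OF finite_lt_pairs]
      using wj by (auto simp: lt_pairs_def inj_XK)
    have "hl_term (cK tt) XK (map w [0..<n]) ?L = (\<Prod>i<n. XK (w i) ^ (?L ! i)) *
       (\<Prod>(i,j)\<in>lt_pairs n. (XK (w i) - cK tt * XK (w j)) / (XK (w i) - XK (w j)))"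
      using assms by (subst hl_term_eq) (auto simp: lt_pairs_def intro!: prod.cong arg_cong2[of _ _ _ _ "(*)"])
    also have "(\<Prod>(i,j)\<in>lt_pairs n. (XK (w i) - cK tt * XK (w j)) / (XK (w i) - XK (w j))) = N / D"
      by (simp add: N_def D_def prod_dividef case_prod_beta)
    finally have h: "hl_term (cK tt) XK (map w [0..<n]) ?L = (\<Prod>i<n. XK (w i) ^ (?L ! i)) * (N / D)" .
    have sq: "(of_int (sign w) :: mpoly fract) * of_int (sign w) = 1"
      by (cases w rule: sign_cases) auto
    have "to_fract (vandermonde n) = of_int (sign w) * D"
      unfolding D mult.assoc[symmetric] sq by simp
    then have VN: "to_fract (vandermonde n) * (N / D) = of_int (sign w) * N"
      using D0 by simp
    show "of_int (sign w) * (\<Prod>i<n. XK (w i) ^ (?L ! i)) * (\<Prod>(i,j)\<in>lt_pairs n. XK (w i) - cK tt * XK (w j))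
      = to_fract (vandermonde n) * hl_term (cK tt) XK (map w [0..<n]) ?L"
      unfolding h N_def[symmetric] mult.left_commute[of "to_fract (vandermonde n)"] VN by (simp only: mult_ac)
  qed
  also have "\<dots> = to_fract (vandermonde n) * (\<Sum>w\<in>?P. hl_term (cK tt) XK (map w [0..<n]) ?L)"
    by (simp add: sum_distrib_left)
  also have "(\<Sum>w\<in>?P. hl_term (cK tt) XK (map w [0..<n]) ?L)
    = (\<Sum>xs\<in>permutations_of_set {..<n}. hl_term (cK tt) XK xs ?L)"
    by (rule sum.reindex_bij_betw[OF bij_betw_permutes_lists])
  also have "\<dots> = hlR (cK tt) XK {..<n} ?L"
    using assms by (intro sum_hl_term) auto
  finally show ?thesis .
qed

section \<open>Coefficients of the Cauchy kernel\<close>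

lemma to_fract_hlq:
  assumes "finite S"
  shows "to_fract (hlq t x S r) = hlq (to_fract t) (\<lambda>i. to_fract (x i)) S r"
  using assms
proof (induction S arbitrary: r)
  case empty
  then show ?case by simp
next
  case (insert i S)
  then show ?case
    by (simp add: hlq_insert to_fract_sum to_fract_power if_distrib[of to_fract] cong: if_cong)
qed

lemma to_fract_hlqs:
  assumes "finite S"
  shows "to_fract (hlqs (Cst tt) Xv S nu) = qK S nu"
  using to_fract_hlq[OF assms, of "Cst tt" Xv]
  by (induction nu) (simp_all add: cK_def XK_def[abs_def])

lemma lookup_Xv_power_mult:
  "Poly_Mapping.lookup (Xv i ^ k * f) al =
    (if k \<le> Poly_Mapping.lookup al i then Poly_Mapping.lookup f (al - Poly_Mapping.single i k) else 0)"
proof -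
  let ?s = "Poly_Mapping.single i k"
  have "Poly_Mapping.lookup (Xv i ^ k * f) al = (\<Sum>q. Poly_Mapping.lookup f q when al = ?s + q)"
    by (simp add: Xv_power lookup_mult lookup_single when_mult)
  also have "\<dots> = (if k \<le> Poly_Mapping.lookup al i then Poly_Mapping.lookup f (al - ?s) else 0)"
  proof (cases "k \<le> Poly_Mapping.lookup al i")
    case True
    then have "al = ?s + (al - ?s)"
      by (intro poly_mapping_eqI) (auto simp: lookup_add lookup_minus lookup_single when_def)
    then have "al = ?s + q \<longleftrightarrow> q = al - ?s" for q
      by (metis add_diff_cancel_left')
    then show ?thesis using True by simp
  next
    case False
    then have "al \<noteq> ?s + q" for q
      by (metis le_add1 lookup_add lookup_single_eq)
    then show ?thesis using False by simp
  qed
  finally show ?thesis .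
qed

lemma lookup_Cst_mult: "Poly_Mapping.lookup (Cst c * f) al = c * Poly_Mapping.lookup f al"
  by (simp add: Cst_def lookup_mult lookup_single when_mult)

text \<open>Leibniz rule: the total degree splits over the factors, and \<open>hlq_newton\<close> is
  applied to factor j.\<close>

lemma hlqs_newton:
  fixes t :: "'a::comm_ring_1"
  assumes "finite S"
  shows "of_nat (sum_list nu) * hlqs t x S nu =
    (\<Sum>j<length nu. \<Sum>k=1..nu ! j. (1 - t ^ k) * (\<Sum>i\<in>S. x i ^ k) * hlqs t x S (nu[j := nu ! j - k]))"
proof (induction nu)
  case (Cons b nu)
  have "of_nat (sum_list (b # nu)) * hlqs t x S (b # nu)
    = (of_nat b * hlq t x S b) * hlqs t x S nu + hlq t x S b * (of_nat (sum_list nu) * hlqs t x S nu)"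
    by (simp add: algebra_simps)
  also have "(of_nat b * hlq t x S b) * hlqs t x S nu
    = (\<Sum>k=1..b. (1 - t ^ k) * (\<Sum>i\<in>S. x i ^ k) * hlqs t x S ((b # nu)[0 := (b # nu) ! 0 - k]))"
    unfolding hlq_newton[OF assms] sum_distrib_right by (simp add: mult.assoc)
  also have "hlq t x S b * (of_nat (sum_list nu) * hlqs t x S nu)
    = (\<Sum>j<length nu. \<Sum>k=1..nu ! j. (1 - t ^ k) * (\<Sum>i\<in>S. x i ^ k) * hlqs t x S ((b # nu)[Suc j := (b # nu) ! Suc j - k]))"
    unfolding Cons.IH sum_distrib_left by (simp add: mult_ac)
  finally show ?case by (simp add: sum.lessThan_Suc_shift del: sum.lessThan_Suc)
qed simp

text \<open>Equivalently, the coefficient of $x^\alpha y^\nu$ in the Cauchy kernel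
  $\prod_{i,j} (1 - t x_i y_j)/(1 - x_i y_j)$.\<close>
definition qco :: "nat \<Rightarrow> nat list \<Rightarrow> (nat \<Rightarrow>\<^sub>0 nat) \<Rightarrow> int poly" where
  "qco N nu al = Poly_Mapping.lookup (hlqs (Cst tt) Xv {..<N} nu) al"

text \<open>Multiplication by a power sum shifts \<open>al\<close>. Since a positive integer cancels
  in Z[t], the recursion determines all \<open>qco\<close> from the case \<open>sum_list nu\<close>
  = 0; homogeneity, stability and symmetry below are inductions along it.\<close>

lemma qco_newton:
  "of_nat (sum_list nu) * qco N nu al =
    (\<Sum>j<length nu. \<Sum>k=1..nu ! j. \<Sum>i<N. if k \<le> Poly_Mapping.lookup al i
      then (1 - tt ^ k) * qco N (nu[j := nu ! j - k]) (al - Poly_Mapping.single i k) else 0)"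
proof -
  have "of_nat (sum_list nu) * qco N nu al = Poly_Mapping.lookup (of_nat (sum_list nu) * hlqs (Cst tt) Xv {..<N} nu) al"
    by (induction ("sum_list nu")) (simp_all add: qco_def distrib_right lookup_add)
  also have "\<dots> = Poly_Mapping.lookup (\<Sum>j<length nu. \<Sum>k=1..nu ! j. \<Sum>i<N.
      Cst (1 - tt ^ k) * (Xv i ^ k * hlqs (Cst tt) Xv {..<N} (nu[j := nu ! j - k]))) al"
    unfolding hlqs_newton[OF finite_lessThan] sum_distrib_left sum_distrib_right by (simp add: mult.assoc)
  also have "\<dots> = (\<Sum>j<length nu. \<Sum>k=1..nu ! j. \<Sum>i<N. (1 - tt ^ k) *
      (if k \<le> Poly_Mapping.lookup al i then qco N (nu[j := nu ! j - k]) (al - Poly_Mapping.single i k) else 0))"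
    by (simp only: lookup_sum lookup_Cst_mult lookup_Xv_power_mult qco_def)
  finally show ?thesis by (simp add: if_distrib[of "\<lambda>z. _ * z"] cong: if_cong)
qed

definition pdeg :: "(nat \<Rightarrow>\<^sub>0 nat) \<Rightarrow> nat" where
  "pdeg al = (\<Sum>i\<in>Poly_Mapping.keys al. Poly_Mapping.lookup al i)"

lemma pdeg_superset: "finite A \<Longrightarrow> Poly_Mapping.keys al \<subseteq> A \<Longrightarrow> pdeg al = (\<Sum>i\<in>A. Poly_Mapping.lookup al i)"
  unfolding pdeg_def by (intro sum.mono_neutral_left) (auto simp: in_keys_iff)

lemma pdeg_add: "pdeg (al + be) = pdeg al + pdeg be"
proof -
  let ?A = "Poly_Mapping.keys al \<union> Poly_Mapping.keys be"
  have "pdeg (al + be) = (\<Sum>i\<in>?A. Poly_Mapping.lookup (al + be) i)"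
    using Poly_Mapping.keys_add[of al be] by (intro pdeg_superset) auto
  also have "\<dots> = (\<Sum>i\<in>?A. Poly_Mapping.lookup al i) + (\<Sum>i\<in>?A. Poly_Mapping.lookup be i)"
    by (simp add: lookup_add sum.distrib)
  also have "\<dots> = pdeg al + pdeg be"
    by (intro arg_cong2[of _ _ _ _ "(+)"] pdeg_superset[symmetric]) auto
  finally show ?thesis .
qed

lemma pdeg_single [simp]: "pdeg (Poly_Mapping.single i k) = k"
  by (simp add: pdeg_def)

lemma pdeg_0 [simp]: "pdeg 0 = 0"
  by (simp add: pdeg_def)

lemma pdeg_eq_0_iff: "pdeg al = 0 \<longleftrightarrow> al = 0"
  by (auto simp: pdeg_def in_keys_iff sum_eq_0_iff intro!: poly_mapping_eqI)

lemma diff_single_add: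
  assumes "k \<le> Poly_Mapping.lookup al i"
  shows "(al - Poly_Mapping.single i k) + Poly_Mapping.single i k = (al :: nat \<Rightarrow>\<^sub>0 nat)"
  using assms by (intro poly_mapping_eqI) (auto simp: lookup_add lookup_minus lookup_single when_def)

lemma pdeg_diff_single:
  assumes "k \<le> Poly_Mapping.lookup al i"
  shows "pdeg (al - Poly_Mapping.single i k) + k = pdeg al"
  using pdeg_add[of "al - Poly_Mapping.single i k" "Poly_Mapping.single i k"] diff_single_add[OF assms] by simp

lemma keys_diff_subset: "Poly_Mapping.keys (al - be) \<subseteq> Poly_Mapping.keys (al :: nat \<Rightarrow>\<^sub>0 nat)"
  by (auto simp: in_keys_iff lookup_minus)

lemma sum_list_update_diff:
  assumes "j < length nu" "1 \<le> k" "k \<le> nu ! j"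
  shows "sum_list (nu[j := nu ! j - k]) + k = sum_list (nu :: nat list)"
  using assms
proof (induction nu arbitrary: j)
  case (Cons a nu)
  then show ?case by (cases j) auto
qed simp

lemma qco_zero_sum:
  assumes "sum_list nu = 0"
  shows "qco N nu al = (if al = 0 then 1 else 0)"
proof -
  have "hlqs (Cst tt) Xv {..<N} nu = 1" using assms by (induction nu) auto
  then show ?thesis by (simp add: qco_def lookup_one when_def)
qed

lemma of_nat_int_poly_mult_cancel: "0 < d \<Longrightarrow> of_nat d * a = of_nat d * b \<Longrightarrow> a = (b :: int poly)"
  by simp

lemma qco_homogeneous:
  assumes "qco N nu al \<noteq> 0"
  shows "Poly_Mapping.keys al \<subseteq> {..<N} \<and> pdeg al = sum_list nu"
  using assms
proof (induction "sum_list nu" arbitrary: nu al rule: less_induct)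
  case less
  show ?case
  proof (cases "sum_list nu = 0")
    case True
    then show ?thesis using less.prems qco_zero_sum[OF True, of N al] by (auto split: if_splits)
  next
    case False
    let ?F = "\<lambda>j k i. if k \<le> Poly_Mapping.lookup al i
      then (1 - tt ^ k) * qco N (nu[j := nu ! j - k]) (al - Poly_Mapping.single i k) else 0"
    have "of_nat (sum_list nu) * qco N nu al \<noteq> 0" using False less.prems by simp
    then have "(\<Sum>j<length nu. \<Sum>k=1..nu ! j. \<Sum>i<N. ?F j k i) \<noteq> 0"
      by (simp only: qco_newton not_False_eq_True)
    then obtain j where j: "j \<in> {..<length nu}" "(\<Sum>k=1..nu ! j. \<Sum>i<N. ?F j k i) \<noteq> 0"
      by (rule sum.not_neutral_contains_not_neutral)
    from j(2) obtain k where k: "k \<in> {1..nu ! j}" "(\<Sum>i<N. ?F j k i) \<noteq> 0"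
      by (rule sum.not_neutral_contains_not_neutral)
    from k(2) obtain i where i: "i \<in> {..<N}" "?F j k i \<noteq> 0"
      by (rule sum.not_neutral_contains_not_neutral)
    have jk: "j < length nu" "k \<in> {1..nu ! j}" "i < N" and nz: "?F j k i \<noteq> 0"
      using i j(1) k(1) by auto
    then have le: "k \<le> Poly_Mapping.lookup al i" and q: "qco N (nu[j := nu ! j - k]) (al - Poly_Mapping.single i k) \<noteq> 0"
      by (auto split: if_splits)
    have s: "sum_list (nu[j := nu ! j - k]) + k = sum_list nu"
      using jk by (intro sum_list_update_diff) auto
    then have "sum_list (nu[j := nu ! j - k]) < sum_list nu" using jk by auto
    from less.hyps[OF this q]
    have IH: "Poly_Mapping.keys (al - Poly_Mapping.single i k) \<subseteq> {..<N}"
      "pdeg (al - Poly_Mapping.single i k) = sum_list (nu[j := nu ! j - k])" by auto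
    have "Poly_Mapping.keys al \<subseteq> {..<N}"
    proof
      fix i' assume "i' \<in> Poly_Mapping.keys al"
      then show "i' \<in> {..<N}"
        using IH(1) jk(3) by (cases "i' = i") (auto simp: in_keys_iff subset_iff lookup_minus lookup_single)
    qed
    then show ?thesis using pdeg_diff_single[OF le] IH(2) s by simp
  qed
qed

text \<open>A variable with index at least N has exponent 0 in \<open>al\<close>, so its terms fail
  the test against k >= 1.\<close>

lemma qco_stable:
  assumes "Poly_Mapping.keys al \<subseteq> {..<N}" "N \<le> N'"
  shows "qco N nu al = qco N' nu al"
  using assms(1)
proof (induction "sum_list nu" arbitrary: nu al rule: less_induct)
  case less
  show ?case
  proof (cases "sum_list nu = 0")
    case True
    then show ?thesis by (simp add: qco_zero_sum)
  next
    case False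
    have "of_nat (sum_list nu) * qco N nu al = of_nat (sum_list nu) * qco N' nu al"
      unfolding qco_newton
    proof (rule sum.cong[OF refl], rule sum.cong[OF refl])
      fix j k assume jk: "j \<in> {..<length nu}" "k \<in> {1..nu ! j}"
      have s: "sum_list (nu[j := nu ! j - k]) + k = sum_list nu"
        using jk by (intro sum_list_update_diff) auto
      then have lt: "sum_list (nu[j := nu ! j - k]) < sum_list nu" using jk by auto
      show "(\<Sum>i<N. if k \<le> Poly_Mapping.lookup al i
          then (1 - tt ^ k) * qco N (nu[j := nu ! j - k]) (al - Poly_Mapping.single i k) else 0)
        = (\<Sum>i<N'. if k \<le> Poly_Mapping.lookup al i
          then (1 - tt ^ k) * qco N' (nu[j := nu ! j - k]) (al - Poly_Mapping.single i k) else 0)"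
      proof (rule sum.mono_neutral_cong_left)
        show "finite {..<N'}" "{..<N} \<subseteq> {..<N'}" using assms(2) by auto
        show "\<forall>i\<in>{..<N'} - {..<N}. (if k \<le> Poly_Mapping.lookup al i
          then (1 - tt ^ k) * qco N' (nu[j := nu ! j - k]) (al - Poly_Mapping.single i k) else 0) = 0"
        proof
          fix i assume "i \<in> {..<N'} - {..<N}"
          then have "Poly_Mapping.lookup al i = 0" using less.prems by (auto simp: in_keys_iff)
          then show "(if k \<le> Poly_Mapping.lookup al i
            then (1 - tt ^ k) * qco N' (nu[j := nu ! j - k]) (al - Poly_Mapping.single i k) else 0) = 0"
            using jk by simp
        qed
        fix i
        have "qco N (nu[j := nu ! j - k]) (al - Poly_Mapping.single i k) = qco N' (nu[j := nu ! j - k]) (al - Poly_Mapping.single i k)"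
          by (rule less.hyps[OF lt]) (use less.prems keys_diff_subset in blast)
        then show "(if k \<le> Poly_Mapping.lookup al i
            then (1 - tt ^ k) * qco N (nu[j := nu ! j - k]) (al - Poly_Mapping.single i k) else 0)
          = (if k \<le> Poly_Mapping.lookup al i
            then (1 - tt ^ k) * qco N' (nu[j := nu ! j - k]) (al - Poly_Mapping.single i k) else 0)" by simp
      qed
    qed
    then show ?thesis by (rule of_nat_int_poly_mult_cancel[rotated]) (rule Nat.gr0I, rule False[THEN notE])
  qed
qed

text \<open>The second index becomes an exponent vector as well, so that both sets of variables
  appear alike and symmetry can be stated.\<close>

definition kernel_co :: "nat \<Rightarrow> (nat \<Rightarrow>\<^sub>0 nat) \<Rightarrow> (nat \<Rightarrow>\<^sub>0 nat) \<Rightarrow> int poly" where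
  "kernel_co N al be = qco N (map (Poly_Mapping.lookup be) [0..<N]) al"

lemma sum_list_lookup: "Poly_Mapping.keys be \<subseteq> {..<N} \<Longrightarrow> sum_list (map (Poly_Mapping.lookup be) [0..<N]) = pdeg be"
  by (subst pdeg_superset[of "{..<N}"]) (auto simp: sum_list_sum_nth atLeast0LessThan)

lemma kernel_co_newton:
  assumes "Poly_Mapping.keys be \<subseteq> {..<N}"
  shows "of_nat (pdeg be) * kernel_co N al be =
    (\<Sum>k=1..pdeg be. \<Sum>i<N. \<Sum>j<N. if k \<le> Poly_Mapping.lookup al i \<and> k \<le> Poly_Mapping.lookup be j
      then (1 - tt ^ k) * kernel_co N (al - Poly_Mapping.single i k) (be - Poly_Mapping.single j k) else 0)"
proof -
  let ?nu = "map (Poly_Mapping.lookup be) [0..<N]"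
  let ?f = "\<lambda>k i j. if k \<le> Poly_Mapping.lookup al i \<and> k \<le> Poly_Mapping.lookup be j
      then (1 - tt ^ k) * kernel_co N (al - Poly_Mapping.single i k) (be - Poly_Mapping.single j k) else 0"
  have "?nu[j := Poly_Mapping.lookup be j - k] = map (Poly_Mapping.lookup (be - Poly_Mapping.single j k)) [0..<N]"
    if "j < N" for j k
    using that by (intro nth_equalityI) (auto simp: nth_list_update lookup_minus lookup_single when_def)
  then have upd: "qco N (?nu[j := Poly_Mapping.lookup be j - k]) ga = kernel_co N ga (be - Poly_Mapping.single j k)"
    if "j < N" for j k ga
    using that by (simp add: kernel_co_def)
  have le: "Poly_Mapping.lookup be j \<le> pdeg be" if "j < N" for j
    unfolding pdeg_superset[OF finite_lessThan assms] using that by (intro member_le_sum) auto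
  have "of_nat (pdeg be) * kernel_co N al be = (\<Sum>j<N. \<Sum>k=1..Poly_Mapping.lookup be j. \<Sum>i<N. ?f k i j)"
    unfolding kernel_co_def[of N al be] sum_list_lookup[OF assms, symmetric] qco_newton
    by (rule sum.cong) (auto simp: upd intro!: sum.cong)
  \<comment> \<open>The added terms have k above the exponent of j and vanish; the range of k no
    longer depends on j, so the sums may be exchanged.\<close>
  also have "\<dots> = (\<Sum>j<N. \<Sum>k=1..pdeg be. \<Sum>i<N. ?f k i j)"
    by (intro sum.cong refl sum.mono_neutral_left) (use le in \<open>auto intro: order.trans\<close>)
  also have "\<dots> = (\<Sum>k=1..pdeg be. \<Sum>j<N. \<Sum>i<N. ?f k i j)"
    by (rule sum.swap)
  also have "\<dots> = (\<Sum>k=1..pdeg be. \<Sum>i<N. \<Sum>j<N. ?f k i j)"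
    by (intro sum.cong refl sum.swap)
  finally show ?thesis .
qed

lemma kernel_co_homogeneous:
  assumes "kernel_co N al be \<noteq> 0" "Poly_Mapping.keys be \<subseteq> {..<N}"
  shows "pdeg al = pdeg be"
  using qco_homogeneous[of N _ al] assms sum_list_lookup[OF assms(2)] unfolding kernel_co_def by metis

text \<open>Newton's recursion is symmetric in the two sets of variables, so the kernel is as well.\<close>
lemma kernel_co_sym:
  assumes "Poly_Mapping.keys al \<subseteq> {..<N}" "Poly_Mapping.keys be \<subseteq> {..<N}"
  shows "kernel_co N al be = kernel_co N be al"
  using assms
proof (induction "pdeg al" arbitrary: al be rule: less_induct)
  case less
  show ?case
  proof (cases "pdeg al = pdeg be")
    case False
    then show ?thesis using kernel_co_homogeneous less.prems by metis
  next
    case True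
    show ?thesis
    proof (cases "pdeg al = 0")
      case True
      then have "al = 0" "be = 0" using \<open>pdeg al = pdeg be\<close> by (auto simp: pdeg_eq_0_iff)
      then show ?thesis by simp
    next
      case False
      have "of_nat (pdeg al) * kernel_co N al be = of_nat (pdeg al) * kernel_co N be al"
        unfolding kernel_co_newton[OF less.prems(1)] unfolding True kernel_co_newton[OF less.prems(2)]
      proof (rule sum.cong[OF refl], subst sum.swap, intro sum.cong refl)
        fix k i j assume k: "k \<in> {1..pdeg be}"
        show "(if k \<le> Poly_Mapping.lookup al i \<and> k \<le> Poly_Mapping.lookup be j
            then (1 - tt ^ k) * kernel_co N (al - Poly_Mapping.single i k) (be - Poly_Mapping.single j k) else 0)
          = (if k \<le> Poly_Mapping.lookup be j \<and> k \<le> Poly_Mapping.lookup al i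
            then (1 - tt ^ k) * kernel_co N (be - Poly_Mapping.single j k) (al - Poly_Mapping.single i k) else 0)"
        proof (cases "k \<le> Poly_Mapping.lookup al i \<and> k \<le> Poly_Mapping.lookup be j")
          case kle: True
          have "pdeg (al - Poly_Mapping.single i k) < pdeg al"
            using pdeg_diff_single[of k al i] kle k by auto
          then have "kernel_co N (al - Poly_Mapping.single i k) (be - Poly_Mapping.single j k)
            = kernel_co N (be - Poly_Mapping.single j k) (al - Poly_Mapping.single i k)"
            by (rule less.hyps) (use less.prems keys_diff_subset in blast)+
          then show ?thesis using kle by simp
        qed auto
      qed
      then show ?thesis by (rule of_nat_int_poly_mult_cancel[rotated]) (rule Nat.gr0I, rule False[THEN notE])
    qed
  qed
qed

definition psort :: "(nat \<Rightarrow>\<^sub>0 nat) \<Rightarrow> nat list" where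
  "psort al = pnorm (map (Poly_Mapping.lookup al) (sorted_list_of_set (Poly_Mapping.keys al)))"

lemma pnorm_lookup:
  assumes "Poly_Mapping.keys al \<subseteq> {..<N}"
  shows "pnorm (map (Poly_Mapping.lookup al) [0..<N]) = psort al"
  unfolding psort_def
proof (rule pnorm_eqI)
  let ?l = "Poly_Mapping.lookup al"
  have mf: "mset (filter (\<lambda>r. r \<noteq> 0) (map ?l is)) = image_mset ?l (filter_mset (\<lambda>i. ?l i \<noteq> 0) (mset is))" for "is"
    by (induction "is") auto
  have "{i \<in> {0..<N}. ?l i \<noteq> 0} = {i \<in> Poly_Mapping.keys al. ?l i \<noteq> 0}"
    using assms by (auto simp: in_keys_iff subset_iff)
  then have "filter_mset (\<lambda>i. ?l i \<noteq> 0) (mset_set {0..<N}) = filter_mset (\<lambda>i. ?l i \<noteq> 0) (mset_set (Poly_Mapping.keys al))"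
    by (simp only: filter_mset_mset_set finite_atLeastLessThan finite_keys)
  then show "mset (filter (\<lambda>r. r \<noteq> 0) (map ?l [0..<N]))
    = mset (filter (\<lambda>r. r \<noteq> 0) (map ?l (sorted_list_of_set (Poly_Mapping.keys al))))"
    unfolding mf by (simp only: mset_upt mset_sorted_list_of_multiset sorted_list_of_mset_set[symmetric])
qed

lemma keys_finite_bound: "\<exists>N. Poly_Mapping.keys (al :: nat \<Rightarrow>\<^sub>0 nat) \<subseteq> {..<N}"
  by (metis finite_keys finite_nat_iff_bounded)

lemma psort_in_Parts: "psort al \<in> Parts (pdeg al)"
proof -
  obtain N where N: "Poly_Mapping.keys al \<subseteq> {..<N}" using keys_finite_bound by blast
  then show ?thesis
    unfolding pnorm_lookup[OF N, symmetric] Parts_def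
    by (simp add: is_partition_pnorm sum_list_pnorm sum_list_lookup)
qed

lemma kernel_co_psort:
  assumes "Poly_Mapping.keys be \<subseteq> {..<N}"
  shows "kernel_co N al be = qco N (psort be) al"
  unfolding kernel_co_def qco_def pnorm_lookup[OF assms, symmetric] hlqs_pnorm ..

lemma keys_pexp: "Poly_Mapping.keys (pexp lam) \<subseteq> {..<length lam}"
  by (auto simp: in_keys_iff nth_default_def simp del: keys_nth split: if_splits)

lemma psort_pexp:
  assumes "is_partition lam"
  shows "psort (pexp lam) = lam"
proof -
  have "map (Poly_Mapping.lookup (pexp lam)) [0..<length lam] = lam"
    by (intro nth_equalityI) (auto simp: nth_default_def)
  then show ?thesis
    using pnorm_lookup[OF keys_pexp, of lam] pnorm_partition[OF assms] by simp
qed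

lemma length_Parts: "lam \<in> Parts d \<Longrightarrow> length lam \<le> d"
  using length_le_sum_list by (auto simp: Parts_def is_partition_def)

text \<open>The matrix H on partitions of d. A partition of d has at most d parts, so d variables
  carry all the exponents \<open>pexp mu\<close>.\<close>

definition hco :: "nat \<Rightarrow> nat list \<Rightarrow> nat list \<Rightarrow> int poly" where
  "hco d nu mu = qco d nu (pexp mu)"

lemma qco_kernel:
  assumes "nu \<in> Parts d" "d \<le> N"
  shows "qco N nu al = kernel_co N al (pexp nu)"
proof -
  have "Poly_Mapping.keys (pexp nu) \<subseteq> {..<N}"
    using keys_pexp[of nu] length_Parts[OF assms(1)] assms(2) by force
  then show ?thesis using kernel_co_psort psort_pexp[of nu] assms(1) by (simp add: Parts_def)
qed

lemma keys_pexp_Parts: "lam \<in> Parts d \<Longrightarrow> d \<le> N \<Longrightarrow> Poly_Mapping.keys (pexp lam) \<subseteq> {..<N}"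
  using keys_pexp[of lam] length_Parts[of lam d] by force

lemma hco_sym:
  assumes "nu \<in> Parts d" "mu \<in> Parts d"
  shows "hco d nu mu = hco d mu nu"
  unfolding hco_def qco_kernel[OF assms(1) order.refl] qco_kernel[OF assms(2) order.refl]
  using assms keys_pexp_Parts by (intro kernel_co_sym) auto

text \<open>That q_nu is symmetric in the x_i is obtained from the kernel: exchanging the two
  exponents moves \<open>al\<close> to the side of the indices of the q_r, where order and zeros do
  not matter.\<close>

lemma qco_eq_hco:
  assumes "nu \<in> Parts d" "Poly_Mapping.keys al \<subseteq> {..<N}" "pdeg al = d"
  shows "qco N nu al = hco d nu (psort al)"
proof -
  define M where "M = max N d"
  have al: "Poly_Mapping.keys al \<subseteq> {..<M}" using assms(2) by (auto simp: M_def)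
  have ps: "psort al \<in> Parts d" using psort_in_Parts[of al] assms(3) by simp
  have "qco N nu al = qco M nu al"
    by (rule qco_stable[OF assms(2)]) (simp add: M_def)
  also have "\<dots> = kernel_co M al (pexp nu)"
    by (rule qco_kernel[OF assms(1)]) (simp add: M_def)
  also have "\<dots> = kernel_co M (pexp nu) al"
    by (rule kernel_co_sym[OF al]) (rule keys_pexp_Parts[OF assms(1)], simp add: M_def)
  also have "\<dots> = qco M (psort al) (pexp nu)"
    by (rule kernel_co_psort[OF al])
  also have "\<dots> = qco d (psort al) (pexp nu)"
    by (rule qco_stable[symmetric]) (use keys_pexp_Parts[OF assms(1)] in \<open>auto simp: M_def\<close>)
  also have "\<dots> = hco d nu (psort al)"
    using hco_sym[OF assms(1) ps] by (simp add: hco_def)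
  finally show ?thesis .
qed

section \<open>The Cauchy identity\<close>

text \<open>Back substitution from the larger indices. No division occurs, so the inverse stays in
  the ring; for Z[t] this is the source of integrality.\<close>

lemma unitriangular_left_inverse:
  fixes A :: "'a \<Rightarrow> 'a \<Rightarrow> 'r::comm_ring_1" and ord :: "'a \<Rightarrow> 'o::linorder"
  assumes "finite P" "inj_on ord P"
    and diag: "\<And>l. l \<in> P \<Longrightarrow> A l l = 1"
    and tri: "\<And>l m. l \<in> P \<Longrightarrow> m \<in> P \<Longrightarrow> A l m \<noteq> 0 \<Longrightarrow> ord l \<le> ord m"
  shows "\<exists>C. \<forall>l\<in>P. \<forall>m\<in>P. (\<Sum>k\<in>P. C l k * A k m) = (if l = m then 1 else 0)"
proof -
  have "\<exists>c. \<forall>m\<in>P. (\<Sum>k\<in>P. c k * A k m) = (if l = m then 1 else 0)" if "l \<in> P" for l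
    using that
  proof (induction "card {k\<in>P. ord l < ord k}" arbitrary: l rule: less_induct)
    case less
    have "\<exists>c. ord l < ord k \<and> k \<in> P \<longrightarrow> (\<forall>m\<in>P. (\<Sum>j\<in>P. c j * A j m) = (if k = m then 1 else 0))" for k
    proof (cases "ord l < ord k \<and> k \<in> P")
      case True
      then have "{j\<in>P. ord k < ord j} \<subset> {j\<in>P. ord l < ord j}" by auto
      then have "card {j\<in>P. ord k < ord j} < card {j\<in>P. ord l < ord j}"
        using assms(1) by (intro psubset_card_mono) auto
      then show ?thesis using less.hyps[of k] True by blast
    qed auto
    then obtain R where R: "\<And>k m. ord l < ord k \<Longrightarrow> k \<in> P \<Longrightarrow> m \<in> P \<Longrightarrow>
        (\<Sum>j\<in>P. R k j * A j m) = (if k = m then 1 else 0)"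
      by metis
    \<comment> \<open>The unit row minus the rows \<open>R k\<close> that cancel the off-diagonal
      entries of row l of A; where k is not above l, \<open>A l k\<close> is 0.\<close>
    define c where "c = (\<lambda>j. (if j = l then 1 else 0) - (\<Sum>k\<in>P - {l}. A l k * R k j))"
    have "(\<Sum>j\<in>P. c j * A j m) = (if l = m then 1 else 0)" if m: "m \<in> P" for m
    proof -
      have "(\<Sum>j\<in>P. c j * A j m) = (\<Sum>j\<in>P. (if j = l then A j m else 0) - (\<Sum>k\<in>P - {l}. A l k * (R k j * A j m)))"
        by (intro sum.cong refl) (simp add: c_def left_diff_distrib sum_distrib_right mult.assoc)
      also have "\<dots> = A l m - (\<Sum>j\<in>P. \<Sum>k\<in>P - {l}. A l k * (R k j * A j m))"
        using less.prems assms(1) by (simp add: sum_subtractf)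
      also have "(\<Sum>j\<in>P. \<Sum>k\<in>P - {l}. A l k * (R k j * A j m)) = (\<Sum>k\<in>P - {l}. A l k * (\<Sum>j\<in>P. R k j * A j m))"
        by (subst sum.swap) (simp add: sum_distrib_left)
      also have "\<dots> = (\<Sum>k\<in>P - {l}. if k = m then A l k else 0)"
      proof (rule sum.cong[OF refl])
        fix k assume k: "k \<in> P - {l}"
        show "A l k * (\<Sum>j\<in>P. R k j * A j m) = (if k = m then A l k else 0)"
        proof (cases "A l k = 0")
          case False
          then have "ord l \<le> ord k" using tri less.prems k by auto
          moreover have "ord l \<noteq> ord k" using assms(2) less.prems k by (auto dest: inj_onD)
          ultimately have "ord l < ord k" by simp
          then have "(\<Sum>j\<in>P. R k j * A j m) = (if k = m then 1 else 0)" using k m by (intro R) auto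
          then show ?thesis by simp
        qed auto
      qed
      finally show ?thesis using m assms(1) diag[OF less.prems] by auto
    qed
    then show ?case by blast
  qed
  then show ?thesis by metis
qed

text \<open>If $A$ is upper unitriangular, $H$ is symmetric and $AH$ is lower triangular with diagonal $b$, then
  $A H A^T$ is both symmetric and triangular, hence equals $\mathrm{diag}(b)$.  For the change of basis from
  Hall--Littlewood functions to the products $q_\nu$ this is the Cauchy identity.\<close>
lemma triangular_symmetric_factorisation:
  fixes A H :: "'a \<Rightarrow> 'a \<Rightarrow> 'r::comm_ring_1" and ord :: "'a \<Rightarrow> 'o::linorder"
  assumes P: "finite P" and inj: "inj_on ord P"
    and diag: "\<And>l. l \<in> P \<Longrightarrow> A l l = 1"
    and tri: "\<And>l m. l \<in> P \<Longrightarrow> m \<in> P \<Longrightarrow> A l m \<noteq> 0 \<Longrightarrow> ord l \<le> ord m"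
    and sym: "\<And>l m. l \<in> P \<Longrightarrow> m \<in> P \<Longrightarrow> H l m = H m l"
    and S: "\<And>l m. l \<in> P \<Longrightarrow> m \<in> P \<Longrightarrow> (\<Sum>k\<in>P. A l k * H k m) = S l m"
    and Stri: "\<And>l m. l \<in> P \<Longrightarrow> m \<in> P \<Longrightarrow> S l m \<noteq> 0 \<Longrightarrow> ord m \<le> ord l"
    and Sdiag: "\<And>l. l \<in> P \<Longrightarrow> S l l = b l"
  shows "\<exists>C. (\<forall>l\<in>P. \<forall>m\<in>P. S l m = b l * C m l) \<and> (\<forall>m\<in>P. \<forall>k\<in>P. H m k = (\<Sum>l\<in>P. b l * C m l * C k l))"
proof -
  obtain C where C: "\<And>l m. l \<in> P \<Longrightarrow> m \<in> P \<Longrightarrow> (\<Sum>k\<in>P. C l k * A k m) = (if l = m then 1 else 0)"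
    using unitriangular_left_inverse[where A = A and ord = ord, OF P inj] diag tri by blast
  define D where "D = (\<lambda>l k. \<Sum>m\<in>P. S l m * A k m)"
  have Dsym: "D l k = D k l" if l: "l \<in> P" and k: "k \<in> P" for l k
  proof -
    have DD: "D l k = (\<Sum>m\<in>P. \<Sum>j\<in>P. A l j * H j m * A k m)" if "l \<in> P" for l k
      unfolding D_def by (intro sum.cong refl) (simp add: S[symmetric] that sum_distrib_right)
    have "D l k = (\<Sum>j\<in>P. \<Sum>m\<in>P. A l j * H j m * A k m)"
      unfolding DD[OF l] by (rule sum.swap)
    also have "\<dots> = D k l"
      unfolding DD[OF k] by (intro sum.cong refl) (simp add: sym mult_ac)
    finally show ?thesis .
  qed
  have Dtri: "ord k \<le> ord l" if lk: "l \<in> P" "k \<in> P" "D l k \<noteq> 0" for l k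
  proof -
    obtain m where m: "m \<in> P" "S l m * A k m \<noteq> 0"
      using lk(3) unfolding D_def by (rule sum.not_neutral_contains_not_neutral)
    then have "S l m \<noteq> 0" "A k m \<noteq> 0" by auto
    then show ?thesis using Stri[OF lk(1) m(1)] tri[OF lk(2) m(1)] by auto
  qed
  have Dlk: "D l k = (if l = k then b l else 0)" if l: "l \<in> P" and k: "k \<in> P" for l k
  proof (cases "l = k")
    case True
    \<comment> \<open>S l m forces m weakly below l, A l m forces it weakly above, so only m = l
      survives.\<close>
    have "D l l = (\<Sum>m\<in>P. if m = l then b l else 0)"
      unfolding D_def
    proof (rule sum.cong[OF refl])
      fix m assume m: "m \<in> P"
      show "S l m * A l m = (if m = l then b l else 0)"
      proof (cases "m = l")
        case False
        then have "ord m \<noteq> ord l" using inj m l by (auto dest: inj_onD)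
        then show ?thesis using False Stri[OF l m] tri[OF l m] by force
      qed (use l in \<open>simp add: diag Sdiag\<close>)
    qed
    then show ?thesis using True l P by simp
  next
    case False
    then have "ord k \<noteq> ord l" using inj k l by (auto dest: inj_onD)
    then have "D l k = 0" using Dtri[OF l k] Dtri[OF k l] Dsym[OF l k] by force
    then show ?thesis using False by simp
  qed
  \<comment> \<open>D = S A^T and C A = 1 give S = D C^T; as D is diagonal, b l divides the whole
    row S l.\<close>
  have SC: "S l m = b l * C m l" if l: "l \<in> P" and m: "m \<in> P" for l m
  proof -
    have "(\<Sum>k\<in>P. D l k * C m k) = (\<Sum>r\<in>P. S l r * (\<Sum>k\<in>P. C m k * A k r))"
      unfolding D_def sum_distrib_left sum_distrib_right by (subst sum.swap) (simp add: mult_ac)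
    also have "\<dots> = (\<Sum>r\<in>P. if r = m then S l r else 0)"
      by (intro sum.cong refl) (simp add: C m)
    also have "\<dots> = S l m" using m P by simp
    finally have "S l m = (\<Sum>k\<in>P. D l k * C m k)" ..
    also have "\<dots> = (\<Sum>k\<in>P. if k = l then b l * C m l else 0)"
      by (intro sum.cong refl) (use l in \<open>auto simp: Dlk\<close>)
    finally show ?thesis using l P by simp
  qed
  have "H m k = (\<Sum>l\<in>P. b l * C m l * C k l)" if m: "m \<in> P" and k: "k \<in> P" for m k
  proof -
    have "(\<Sum>l\<in>P. b l * C m l * C k l) = (\<Sum>l\<in>P. C m l * (\<Sum>n\<in>P. A l n * H n k))"
      by (intro sum.cong refl) (simp add: S k SC mult_ac)
    also have "\<dots> = (\<Sum>n\<in>P. (\<Sum>l\<in>P. C m l * A l n) * H n k)"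
      unfolding sum_distrib_left sum_distrib_right by (subst sum.swap) (simp add: mult_ac)
    also have "\<dots> = (\<Sum>n\<in>P. if n = m then H n k else 0)"
      by (intro sum.cong refl) (simp add: C m)
    finally show ?thesis using m P by simp
  qed
  then show ?thesis using SC by blast
qed

section \<open>The polynomials Q_lambda and the coefficients of P_lambda\<close>

definition expand_co :: "nat list \<Rightarrow> nat list \<Rightarrow> int poly" where
  "expand_co = (SOME A. \<forall>d. \<forall>lam\<in>Parts d. A lam lam = 1 \<and>
     (\<forall>nu. A lam nu \<noteq> 0 \<longrightarrow> pexp lam \<le> pexp nu) \<and>
     (\<forall>S. finite S \<longrightarrow> (1 - cK tt) ^ length lam * hlR (cK tt) XK S lam = (\<Sum>nu\<in>Parts d. cK (A lam nu) * qK S nu)))"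

lemma expand_co:
  assumes "lam \<in> Parts d"
  shows "expand_co lam lam = 1"
    and "expand_co lam nu \<noteq> 0 \<Longrightarrow> pexp lam \<le> pexp nu"
    and "finite S \<Longrightarrow> (1 - cK tt) ^ length lam * hlR (cK tt) XK S lam = (\<Sum>nu\<in>Parts d. cK (expand_co lam nu) * qK S nu)"
  using someI_ex[OF hlR_expansion] assms unfolding expand_co_def[symmetric] by blast+

text \<open>Q_lambda as an element of \<open>mpoly\<close> rather than of the fraction field, so
  that its coefficients can be read off.\<close>

definition HLQpoly :: "nat \<Rightarrow> nat list \<Rightarrow> mpoly" where
  "HLQpoly N lam = (\<Sum>nu\<in>Parts (sum_list lam). Cst (expand_co lam nu) * hlqs (Cst tt) Xv {..<N} nu)"

lemma to_fract_HLQpoly: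
  assumes "is_partition lam"
  shows "to_fract (HLQpoly N lam) = (1 - cK tt) ^ length lam * hlR (cK tt) XK {..<N} lam"
proof -
  have "lam \<in> Parts (sum_list lam)" using assms by (simp add: Parts_def)
  from expand_co(3)[OF this, of "{..<N}"] show ?thesis
    by (simp add: HLQpoly_def to_fract_sum to_fract_hlqs flip: cK_def)
qed

lemma lookup_HLQpoly:
  "Poly_Mapping.lookup (HLQpoly N lam) al = (\<Sum>nu\<in>Parts (sum_list lam). expand_co lam nu * qco N nu al)"
  by (simp add: HLQpoly_def lookup_sum lookup_Cst_mult qco_def)

text \<open>Links Q_lambda to the given definition: with \<open>blam_vlam\<close> this becomes (1 -
  t)^(length lam) times the equation that defines \<open>HLPn\<close>.\<close>

lemma HLQpoly_antisym:
  assumes "is_partition lam" "length lam \<le> n"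
  shows "(1 - Cst tt) ^ length lam * antisymHL n lam = Cst (vm (n - length lam)) * HLQpoly n lam * vandermonde n"
proof -
  have "to_fract ((1 - Cst tt) ^ length lam * antisymHL n lam)
    = (1 - cK tt) ^ length lam * (to_fract (vandermonde n) * (cK (vm (n - length lam)) * hlR (cK tt) XK {..<n} lam))"
    using assms(2) hlR_append_zeros[of "{..<n}" lam "n - length lam"]
    by (simp add: to_fract_power antisymHL_eq_hlR flip: cK_def)
  also have "\<dots> = to_fract (Cst (vm (n - length lam)) * HLQpoly n lam * vandermonde n)"
    by (simp add: to_fract_HLQpoly[OF assms(1)] mult_ac flip: cK_def)
  finally show ?thesis by (simp only: to_fract_eq_iff)
qed

lemma poly_vm_0: "poly (vm m) 0 = 1"
proof -
  have "poly (\<Sum>j\<le>k. tt ^ j) 0 = 1" for k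
    by (induction k) (auto simp: tt_def)
  then show ?thesis by (induction m) (auto simp: vm_Suc)
qed

lemma vm_nonzero: "vm m \<noteq> 0"
  using poly_vm_0[of m] by auto

lemma lookup_set_exp:
  "Poly_Mapping.lookup (set_exp {m..<m + length lam} lam) j = (if m \<le> j then nth_default 0 lam (j - m) else 0)"
proof (induction lam arbitrary: m)
  case (Cons a lam)
  have M: "Min {m..<m + length (a # lam)} = m" by (intro Min_eqI) auto
  have R: "{m..<m + length (a # lam)} - {m} = {Suc m..<Suc m + length lam}" by auto
  show ?case
    unfolding set_exp.simps M R lookup_add Cons.IH
    by (auto simp: lookup_single nth_default_Cons when_def split: nat.split
        intro!: arg_cong[of _ _ "nth_default 0 lam"])
qed (simp add: nth_default_def)

lemma set_exp_eq_pexp: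
  assumes "length lam \<le> n"
  shows "set_exp {..<n} (lam @ replicate (n - length lam) 0) = pexp lam"
proof (rule poly_mapping_eqI)
  fix j
  let ?L = "lam @ replicate (n - length lam) 0"
  have "{..<n} = {0..<0 + length ?L}" using assms by auto
  then show "Poly_Mapping.lookup (set_exp {..<n} ?L) j = Poly_Mapping.lookup (pexp lam) j"
    using lookup_set_exp[of 0 ?L j] by (auto simp: nth_default_def nth_append)
qed

text \<open>The padded product has top coefficient v_lambda, and the power of 1 - t turns it into
  b_lambda v_m with m = \<open>n - length lam\<close>; the factor v_m belongs to the padding and
  cancels.\<close>

lemma leads_HLQpoly:
  assumes "is_partition lam" "length lam \<le> n"
  shows "leads (HLQpoly n lam) (pexp lam) (blam lam)"
proof -
  let ?m = "n - length lam"
  let ?L = "lam @ replicate ?m 0"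
  have "leadsK (hlR (cK tt) XK {..<n} ?L) (set_exp {..<n} ?L) (run_coeff ?L)"
    using assms(2) partition_bounds(2)[OF assms(1)] by (intro leadsK_hlR) auto
  then have "leadsK (cK ((1 - tt) ^ length lam) * hlR (cK tt) XK {..<n} ?L) (0 + pexp lam) ((1 - tt) ^ length lam * vlam n lam)"
    unfolding set_exp_eq_pexp[OF assms(2)] vlam_eq_run_coeff[OF assms] by (intro leadsK_mult leadsK_cK)
  also have "cK ((1 - tt) ^ length lam) * hlR (cK tt) XK {..<n} ?L = to_fract (Cst (vm ?m) * HLQpoly n lam)"
    using assms(2) hlR_append_zeros[of "{..<n}" lam ?m]
    by (simp add: to_fract_HLQpoly[OF assms(1)] mult_ac flip: cK_def)
  finally have l: "leads (Cst (vm ?m) * HLQpoly n lam) (pexp lam) (blam lam * vm ?m)"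
    using leadsK_to_fractD blam_vlam[OF assms] by simp
  show ?thesis
  proof (rule leadsI)
    show "Poly_Mapping.lookup (HLQpoly n lam) (pexp lam) = blam lam"
      using leads_lookup[OF l] vm_nonzero[of ?m] by (simp add: lookup_Cst_mult mult.commute[of "blam lam"])
    fix be assume "Poly_Mapping.lookup (HLQpoly n lam) be \<noteq> 0"
    then show "be \<le> pexp lam"
      using leads_keys_le[OF l, of be] vm_nonzero[of ?m] by (simp add: lookup_Cst_mult)
  qed
qed

text \<open>The coefficient of $x^\alpha$ in $P_\lambda$ is \<open>hlP_co |\<lambda>| (psort \<alpha>) \<lambda>\<close> if $|\alpha| = |\lambda|$.\<close>
definition hlP_co :: "nat \<Rightarrow> nat list \<Rightarrow> nat list \<Rightarrow> int poly" where
  "hlP_co d = (SOME C.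
     (\<forall>lam\<in>Parts d. \<forall>mu\<in>Parts d. (\<Sum>nu\<in>Parts d. expand_co lam nu * hco d nu mu) = blam lam * C mu lam) \<and>
     (\<forall>mu\<in>Parts d. \<forall>ka\<in>Parts d. hco d mu ka = (\<Sum>lam\<in>Parts d. blam lam * C mu lam * C ka lam)))"

text \<open>The factorisation for the finite index set \<open>Parts d\<close>, where row lambda of
  AH lists the coefficients of Q_lambda. The first identity says that b_lambda divides them; the
  second is the Cauchy identity in degree d.\<close>

lemma hlP_co:
  shows "lam \<in> Parts d \<Longrightarrow> mu \<in> Parts d \<Longrightarrow> (\<Sum>nu\<in>Parts d. expand_co lam nu * hco d nu mu) = blam lam * hlP_co d mu lam"
    and "mu \<in> Parts d \<Longrightarrow> ka \<in> Parts d \<Longrightarrow> hco d mu ka = (\<Sum>lam\<in>Parts d. blam lam * hlP_co d mu lam * hlP_co d ka lam)"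
proof -
  have S: "Poly_Mapping.lookup (HLQpoly d lam) (pexp mu) = (\<Sum>nu\<in>Parts d. expand_co lam nu * hco d nu mu)"
    if "lam \<in> Parts d" for lam mu
    using that by (simp add: lookup_HLQpoly hco_def Parts_def)
  have L: "leads (HLQpoly d lam) (pexp lam) (blam lam)" if "lam \<in> Parts d" for lam
    using that length_Parts[OF that] by (intro leads_HLQpoly) (auto simp: Parts_def)
  have "\<exists>C. (\<forall>lam\<in>Parts d. \<forall>mu\<in>Parts d. (\<Sum>nu\<in>Parts d. expand_co lam nu * hco d nu mu) = blam lam * C mu lam) \<and>
     (\<forall>mu\<in>Parts d. \<forall>ka\<in>Parts d. hco d mu ka = (\<Sum>lam\<in>Parts d. blam lam * C mu lam * C ka lam))"
  proof (rule triangular_symmetric_factorisation[where ord = pexp and A = expand_co])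
    show "inj_on pexp (Parts d)" using pexp_inj by (auto simp: inj_on_def Parts_def)
    show "hco d l m = hco d m l" if "l \<in> Parts d" "m \<in> Parts d" for l m
      using that by (rule hco_sym)
    show "pexp m \<le> pexp l" if "l \<in> Parts d" "m \<in> Parts d" "(\<Sum>nu\<in>Parts d. expand_co l nu * hco d nu m) \<noteq> 0" for l m
      using leads_keys_le[OF L[OF that(1)]] that S by metis
    show "(\<Sum>nu\<in>Parts d. expand_co l nu * hco d nu l) = blam l" if "l \<in> Parts d" for l
      using leads_lookup[OF L[OF that]] S[OF that] by simp
  qed (use expand_co in auto)
  from someI_ex[OF this] show
    "lam \<in> Parts d \<Longrightarrow> mu \<in> Parts d \<Longrightarrow> (\<Sum>nu\<in>Parts d. expand_co lam nu * hco d nu mu) = blam lam * hlP_co d mu lam"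
    "mu \<in> Parts d \<Longrightarrow> ka \<in> Parts d \<Longrightarrow> hco d mu ka = (\<Sum>lam\<in>Parts d. blam lam * hlP_co d mu lam * hlP_co d ka lam)"
    unfolding hlP_co_def[symmetric] by blast+
qed

lemma poly_phim_0: "poly (phim m) 0 = 1"
  by (auto simp: phim_def poly_prod tt_def intro!: prod.neutral)

lemma blam_nonzero: "blam lam \<noteq> 0"
proof -
  have "poly (blam lam) 0 = 1" by (simp add: blam_def poly_prod poly_phim_0)
  then show ?thesis by auto
qed

lemma lookup_HLQpoly_hlP_co:
  assumes "is_partition lam" "Poly_Mapping.keys al \<subseteq> {..<N}"
  shows "Poly_Mapping.lookup (HLQpoly N lam) al =
    (if pdeg al = sum_list lam then blam lam * hlP_co (sum_list lam) (psort al) lam else 0)"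
proof (cases "pdeg al = sum_list lam")
  case True
  have "(\<Sum>nu\<in>Parts (sum_list lam). expand_co lam nu * qco N nu al)
    = (\<Sum>nu\<in>Parts (sum_list lam). expand_co lam nu * hco (sum_list lam) nu (psort al))"
    using assms(2) True by (intro sum.cong refl) (simp add: qco_eq_hco)
  also have "\<dots> = blam lam * hlP_co (sum_list lam) (psort al) lam"
    using assms(1) psort_in_Parts[of al] True by (intro hlP_co(1)) (auto simp: Parts_def)
  finally show ?thesis using True by (simp add: lookup_HLQpoly)
next
  case False
  have "qco N nu al = 0" if "nu \<in> Parts (sum_list lam)" for nu
    using qco_homogeneous[of N nu al] False that by (auto simp: Parts_def)
  then show ?thesis using False by (simp add: lookup_HLQpoly)
qed

lemma keys_HLQpoly:
  "al \<in> Poly_Mapping.keys (HLQpoly N lam) \<Longrightarrow> Poly_Mapping.keys al \<subseteq> {..<N}"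
proof -
  assume "al \<in> Poly_Mapping.keys (HLQpoly N lam)"
  then have "(\<Sum>nu\<in>Parts (sum_list lam). expand_co lam nu * qco N nu al) \<noteq> 0"
    by (simp add: in_keys_iff lookup_HLQpoly)
  then obtain nu where "expand_co lam nu * qco N nu al \<noteq> 0"
    by (rule sum.not_neutral_contains_not_neutral)
  then show ?thesis using qco_homogeneous[of N nu al] by auto
qed

text \<open>The \<open>THE\<close> needs a witness: Q_lambda with b_lambda struck from every
  coefficient. Its equation is checked after multiplication by a power of 1 - t; uniqueness holds
  because v_lambda and the Vandermonde product are nonzero in an integral domain.\<close>

lemma lookup_HLPn:
  assumes "is_partition lam" "length lam \<le> N" "Poly_Mapping.keys al \<subseteq> {..<N}"
  shows "Poly_Mapping.lookup (HLPn N lam) al = (if pdeg al = sum_list lam then hlP_co (sum_list lam) (psort al) lam else 0)"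
proof -
  let ?d = "sum_list lam" and ?Q = "HLQpoly N lam"
  \<comment> \<open>Summing over the support of Q_lambda keeps \<open>p\<close> a polynomial, and
    loses nothing since b_lambda is nonzero.\<close>
  define p where "p = (\<Sum>ga\<in>Poly_Mapping.keys ?Q. Poly_Mapping.single ga (hlP_co ?d (psort ga) lam))"
  have lp: "Poly_Mapping.lookup p ga = (if ga \<in> Poly_Mapping.keys ?Q then hlP_co ?d (psort ga) lam else 0)" for ga
    by (simp add: p_def lookup_sum lookup_single when_def)
  have Q: "?Q = Cst (blam lam) * p"
  proof (rule poly_mapping_eqI)
    fix ga
    show "Poly_Mapping.lookup ?Q ga = Poly_Mapping.lookup (Cst (blam lam) * p) ga"
    proof (cases "ga \<in> Poly_Mapping.keys ?Q")
      case True
      then show ?thesis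
        using lookup_HLQpoly_hlP_co[OF assms(1) keys_HLQpoly[OF True]]
        by (auto simp: lookup_Cst_mult lp in_keys_iff split: if_splits)
    qed (simp add: lookup_Cst_mult lp in_keys_iff)
  qed
  have t: "(1 - Cst tt) ^ length lam \<noteq> 0"
    using tt_neq_1 by (metis Cst_eq_iff Cst_hom(2) power_not_zero right_minus_eq)
  have "(1 - Cst tt) ^ length lam * (Cst (vlam N lam) * p * vandermonde N)
    = Cst ((1 - tt) ^ length lam * vlam N lam) * p * vandermonde N"
    by (simp add: mult_ac)
  also have "\<dots> = Cst (vm (N - length lam)) * ?Q * vandermonde N"
    unfolding blam_vlam[OF assms(1,2), symmetric] Q by (simp add: mult_ac)
  also have "\<dots> = (1 - Cst tt) ^ length lam * antisymHL N lam"
    by (rule HLQpoly_antisym[OF assms(1,2), symmetric])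
  finally have p: "Cst (vlam N lam) * p * vandermonde N = antisymHL N lam"
    by (rule mult_left_cancel[OF t, THEN iffD1])
  have "vlam N lam \<noteq> 0"
    using blam_vlam[OF assms(1,2)] blam_nonzero[of lam] vm_nonzero[of "N - length lam"] by auto
  then have v: "Cst (vlam N lam) \<noteq> 0" by (metis Cst_eq_iff Cst_hom(1))
  have "HLPn N lam = p"
    unfolding HLPn_def
  proof (subst if_not_P)
    show "\<not> N < length lam" using assms(2) by simp
    show "(THE p. Cst (vlam N lam) * p * vandermonde N = antisymHL N lam) = p"
    proof (rule the_equality[where P = "\<lambda>p. Cst (vlam N lam) * p * vandermonde N = antisymHL N lam", OF p])
      fix q assume "Cst (vlam N lam) * q * vandermonde N = antisymHL N lam"
      then have "Cst (vlam N lam) * q * vandermonde N = Cst (vlam N lam) * p * vandermonde N" using p by simp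
      then show "q = p" using v vandermonde_nonzero[of N] by simp
    qed
  qed
  moreover have "Poly_Mapping.lookup p al = (if pdeg al = ?d then hlP_co ?d (psort al) lam else 0)"
    using lookup_HLQpoly_hlP_co[OF assms(1,3)] blam_nonzero[of lam]
    by (auto simp: lp in_keys_iff split: if_splits)
  ultimately show ?thesis by simp
qed

lemma HLP_eq:
  assumes "is_partition lam"
  shows "HLP lam al = (if pdeg al = sum_list lam then hlP_co (sum_list lam) (psort al) lam else 0)"
  unfolding HLP_def
proof (rule lookup_HLPn[OF assms])
  show "length lam \<le> nvars al lam" by (simp add: nvars_def)
  show "Poly_Mapping.keys al \<subseteq> {..<nvars al lam}"
    by (auto simp: nvars_def less_Suc_eq_le intro!: trans_le_add1 Max_ge)
qed

text \<open>Only partitions of size \<open>pdeg al\<close> contribute to this coefficient, so the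
  weight leaves the sum. With weights 1, d and d^2 this covers Z and both moments.\<close>

lemma HL_weighted_sum:
  fixes w :: "nat \<Rightarrow> int poly"
  assumes "Poly_Mapping.keys al \<subseteq> {..<N}" "Poly_Mapping.keys be \<subseteq> {..<N}"
  shows "fsum (\<lambda>lam. ps_scale (w (psize lam)) (tensor (HLQ lam) (HLP lam))) {lam. is_partition lam} (al, be)
    = w (pdeg al) * kernel_co N al be"
proof -
  let ?f = "\<lambda>lam. ps_scale (w (psize lam)) (tensor (HLQ lam) (HLP lam)) (al, be)"
  define d where "d = pdeg al"
  have f: "?f lam = w (sum_list lam) * (blam lam * HLP lam al * HLP lam be)" for lam
    by (simp add: ps_scale_def tensor_def HLQ_def psize_def mult_ac)
  show ?thesis
  proof (cases "pdeg be = d")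
    case True
    have "fsum (\<lambda>lam. ps_scale (w (psize lam)) (tensor (HLQ lam) (HLP lam))) {lam. is_partition lam} (al, be)
      = (\<Sum>lam\<in>Parts d. ?f lam)"
      unfolding fsum_def
    proof (rule sum.mono_neutral_left)
      show "{lam \<in> {lam. is_partition lam}. ?f lam \<noteq> 0} \<subseteq> Parts d"
        by (auto simp: Parts_def f HLP_eq d_def split: if_splits)
      show "finite (Parts d)" by simp
    qed (auto simp: Parts_def)
    also have "\<dots> = (\<Sum>lam\<in>Parts d. w d * (blam lam * hlP_co d (psort be) lam * hlP_co d (psort al) lam))"
      using True by (intro sum.cong refl) (auto simp: f HLP_eq Parts_def d_def mult_ac)
    also have "\<dots> = w d * hco d (psort be) (psort al)"
      using psort_in_Parts[of al] psort_in_Parts[of be] True d_def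
      by (subst hlP_co(2)) (auto simp: sum_distrib_left)
    also have "hco d (psort be) (psort al) = kernel_co N al be"
      using psort_in_Parts[of be] True assms by (simp add: kernel_co_psort qco_eq_hco d_def)
    finally show ?thesis by (simp add: d_def)
  next
    case False
    have "?f lam = 0" if "is_partition lam" for lam
      using False that unfolding f by (auto simp: HLP_eq d_def)
    then have "fsum (\<lambda>lam. ps_scale (w (psize lam)) (tensor (HLQ lam) (HLP lam))) {lam. is_partition lam} (al, be) = 0"
      unfolding fsum_def by (intro sum.neutral) auto
    moreover have "kernel_co N al be = 0"
      using kernel_co_homogeneous[OF _ assms(2), of al] False by (auto simp: d_def)
    ultimately show ?thesis by simp
  qed
qed

section \<open>Moments\<close>

lemma ps_mult_altdef: "ps_mult f g m = (\<Sum>(a,b)\<in>{(a,b). a + b = m}. f a * g b)"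
  unfolding ps_mult_def by (intro sum.cong) (auto simp: prod_eq_iff)

lemma finite_below_exponent: "finite {be :: nat \<Rightarrow>\<^sub>0 nat. \<forall>i. Poly_Mapping.lookup be i \<le> Poly_Mapping.lookup al i}"
proof (rule finite_imageD)
  let ?M = "Max (insert 0 (Poly_Mapping.lookup al ` Poly_Mapping.keys al))"
  let ?F = "{f. \<forall>i. (i \<in> Poly_Mapping.keys al \<longrightarrow> f i \<in> {..?M}) \<and> (i \<notin> Poly_Mapping.keys al \<longrightarrow> f i = 0)}"
  have "finite ?F" by (rule finite_set_of_finite_funs) auto
  moreover have "Poly_Mapping.lookup ` {be. \<forall>i. Poly_Mapping.lookup be i \<le> Poly_Mapping.lookup al i} \<subseteq> ?F"
  proof clarify
    fix be :: "nat \<Rightarrow>\<^sub>0 nat" and i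
    assume le: "\<forall>i. Poly_Mapping.lookup be i \<le> Poly_Mapping.lookup al i"
    show "(i \<in> Poly_Mapping.keys al \<longrightarrow> Poly_Mapping.lookup be i \<in> {..?M}) \<and>
      (i \<notin> Poly_Mapping.keys al \<longrightarrow> Poly_Mapping.lookup be i = 0)"
    proof (intro conjI impI)
      assume "i \<in> Poly_Mapping.keys al"
      then have "Poly_Mapping.lookup al i \<le> ?M" by (intro Max_ge) auto
      then show "Poly_Mapping.lookup be i \<in> {..?M}" using le[rule_format, of i] by auto
    next
      assume "i \<notin> Poly_Mapping.keys al"
      then show "Poly_Mapping.lookup be i = 0" using le[rule_format, of i] by (simp add: in_keys_iff)
    qed
  qed
  ultimately show "finite (Poly_Mapping.lookup ` {be. \<forall>i. Poly_Mapping.lookup be i \<le> Poly_Mapping.lookup al i})"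
    by (rule rev_finite_subset)
  show "inj_on Poly_Mapping.lookup {be. \<forall>i. Poly_Mapping.lookup be i \<le> Poly_Mapping.lookup al i}"
    by (intro inj_onI poly_mapping_eqI) metis
qed

text \<open>A sum over an infinite set is 0 by convention; finiteness is what makes
  \<open>ps_mult\<close> behave as a product.\<close>

lemma finite_decompositions [simp]:
  "finite {(a, b). a + b = (m :: (nat \<Rightarrow>\<^sub>0 nat) \<times> (nat \<Rightarrow>\<^sub>0 nat))}"
proof (rule finite_subset)
  let ?B = "\<lambda>al. {be :: nat \<Rightarrow>\<^sub>0 nat. \<forall>i. Poly_Mapping.lookup be i \<le> Poly_Mapping.lookup al i}"
  show "{(a, b). a + b = m} \<subseteq> (?B (fst m) \<times> ?B (snd m)) \<times> (?B (fst m) \<times> ?B (snd m))"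
    by (auto simp: lookup_add)
  show "finite ((?B (fst m) \<times> ?B (snd m)) \<times> (?B (fst m) \<times> ?B (snd m)))"
    by (intro finite_cartesian_product finite_below_exponent)
qed

lemma ps_mult_assoc: "ps_mult (ps_mult f g) h = ps_mult f (ps_mult g h)"
proof
  fix m
  let ?D = "\<lambda>m :: (nat \<Rightarrow>\<^sub>0 nat) \<times> (nat \<Rightarrow>\<^sub>0 nat). {(a, b). a + b = m}"
  have "ps_mult (ps_mult f g) h m = (\<Sum>p\<in>?D m. \<Sum>q\<in>?D (fst p). f (fst q) * g (snd q) * h (snd p))"
    by (simp add: ps_mult_altdef case_prod_beta sum_distrib_right)
  also have "\<dots> = (\<Sum>(p, q)\<in>(SIGMA p:?D m. ?D (fst p)). f (fst q) * g (snd q) * h (snd p))"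
    by (rule sum.Sigma) auto
  also have "\<dots> = (\<Sum>(p, q)\<in>(SIGMA p:?D m. ?D (snd p)). f (fst p) * (g (fst q) * h (snd q)))"
    by (rule sum.reindex_bij_witness[of _
        "\<lambda>(p, q). ((fst p + fst q, snd q), (fst p, fst q))"
        "\<lambda>(p, q). ((fst q, snd q + snd p), (snd q, snd p))"]) (auto simp: add.assoc mult.assoc)
  also have "\<dots> = (\<Sum>p\<in>?D m. \<Sum>q\<in>?D (snd p). f (fst p) * (g (fst q) * h (snd q)))"
    by (rule sum.Sigma[symmetric]) auto
  also have "\<dots> = ps_mult f (ps_mult g h) m"
    by (simp add: ps_mult_altdef case_prod_beta sum_distrib_left)
  finally show "ps_mult (ps_mult f g) h m = ps_mult f (ps_mult g h) m" .
qed

lemma ps_mult_add_right: "ps_mult f (\<lambda>m. g m + h m) = (\<lambda>m. ps_mult f g m + ps_mult f h m)"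
  by (rule ext) (simp add: ps_mult_altdef distrib_left sum.distrib case_prod_beta)

text \<open>Degree in X alone: the series it is applied to have equal degrees in X and Y in every
  nonzero coefficient.\<close>

definition euler :: "fps2 \<Rightarrow> fps2" where
  "euler f m = of_nat (pdeg (fst m)) * f m"

lemma euler_ps_mult: "euler (ps_mult f g) = (\<lambda>m. ps_mult (euler f) g m + ps_mult f (euler g) m)"
proof
  fix m
  have "euler (ps_mult f g) m = (\<Sum>(a,b)\<in>{(a,b). a + b = m}. of_nat (pdeg (fst a) + pdeg (fst b)) * (f a * g b))"
    unfolding euler_def ps_mult_altdef sum_distrib_left by (intro sum.cong) (auto simp: pdeg_add)
  also have "\<dots> = ps_mult (euler f) g m + ps_mult f (euler g) m"
    unfolding ps_mult_altdef sum.distrib[symmetric] by (intro sum.cong) (auto simp: euler_def algebra_simps)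
  finally show "euler (ps_mult f g) m = ps_mult (euler f) g m + ps_mult f (euler g) m" .
qed

text \<open>Induction on total degree: at m, every decomposition except (0, m) involves only
  coefficients of lower degree. It provides the uniqueness behind the \<open>THE\<close> of
  \<open>ps_div\<close>.\<close>

lemma ps_mult_left_cancel:
  assumes "f (0, 0) = 1" "ps_mult f g = ps_mult f h"
  shows "g = h"
proof
  fix m
  show "g m = h m"
  proof (induction "pdeg (fst m) + pdeg (snd m)" arbitrary: m rule: less_induct)
    case less
    let ?D = "{(a, b). a + b = m}"
    have z: "(0, m) \<in> ?D" by simp
    have split: "ps_mult f u m = u m + (\<Sum>(a,b)\<in>?D - {(0, m)}. f a * u b)" for u
      unfolding ps_mult_altdef using assms(1)
      by (subst sum.remove[OF _ z]) (auto simp: zero_prod_def)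
    have "(\<Sum>(a,b)\<in>?D - {(0, m)}. f a * g b) = (\<Sum>(a,b)\<in>?D - {(0, m)}. f a * h b)"
    proof (rule sum.cong[OF refl])
      fix p assume p: "p \<in> ?D - {(0, m)}"
      obtain a b where ab: "p = (a, b)" by (cases p)
      then have "a \<noteq> 0" "m = a + b" using p by auto
      then have "0 < pdeg (fst a) + pdeg (snd a)"
        using pdeg_eq_0_iff[of "fst a"] pdeg_eq_0_iff[of "snd a"] by (auto simp: prod_eq_iff)
      then have "g b = h b" using \<open>m = a + b\<close> by (intro less.hyps) (auto simp: pdeg_add)
      then show "(case p of (a, b) \<Rightarrow> f a * g b) = (case p of (a, b) \<Rightarrow> f a * h b)"
        by (simp add: ab)
    qed
    then show ?case using fun_cong[OF assms(2), of m] by (simp add: split)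
  qed
qed

lemma ps_div_eqI: "f (0, 0) = 1 \<Longrightarrow> ps_mult f h = g \<Longrightarrow> ps_div g f = h"
  unfolding ps_div_def by (rule the_equality) (auto dest: ps_mult_left_cancel)

definition powsum_series :: "(nat \<Rightarrow> int poly) \<Rightarrow> fps2" where
  "powsum_series c = fsum (\<lambda>k. ps_scale (c k) (tensor (powsum k) (powsum k))) {1..}"

lemma powsum_series_eq:
  "powsum_series c (al, be) =
    (if 1 \<le> pdeg al then c (pdeg al) * (powsum (pdeg al) al * powsum (pdeg al) be) else 0)"
proof -
  let ?F = "\<lambda>k. ps_scale (c k) (tensor (powsum k) (powsum k)) (al, be)"
  have "?F k \<noteq> 0 \<Longrightarrow> k = pdeg al" for k
    by (auto simp: ps_scale_def tensor_def powsum_def split: if_splits)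
  then have "{k \<in> {1..}. ?F k \<noteq> 0} = {k \<in> {1..}. k = pdeg al \<and> ?F k \<noteq> 0}" by auto
  also have "\<dots> = (if 1 \<le> pdeg al \<and> ?F (pdeg al) \<noteq> 0 then {pdeg al} else {})" by auto
  finally show ?thesis
    unfolding powsum_series_def fsum_def by (auto simp: ps_scale_def tensor_def)
qed

lemma powsum_series_single:
  "1 \<le> k \<Longrightarrow> powsum_series c (Poly_Mapping.single i k, Poly_Mapping.single j k) = c k"
  by (auto simp: powsum_series_eq powsum_def)

lemma powsum_series_nonzeroD:
  assumes "powsum_series c (al, be) \<noteq> 0"
  shows "\<exists>k\<ge>1. \<exists>i j. al = Poly_Mapping.single i k \<and> be = Poly_Mapping.single j k"
  using assms by (auto simp: powsum_series_eq powsum_def split: if_splits)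

lemma euler_powsum_series: "euler (powsum_series c) = powsum_series (\<lambda>k. of_nat k * c k)"
proof
  fix m :: "(nat \<Rightarrow>\<^sub>0 nat) \<times> (nat \<Rightarrow>\<^sub>0 nat)"
  show "euler (powsum_series c) m = powsum_series (\<lambda>k. of_nat k * c k) m"
    by (cases m) (simp add: euler_def powsum_series_eq mult.assoc)
qed

section \<open>The Euler equation for Z\<close>

lemma exponents_bound:
  "\<exists>N. Poly_Mapping.keys (al :: nat \<Rightarrow>\<^sub>0 nat) \<subseteq> {..<N} \<and> Poly_Mapping.keys (be :: nat \<Rightarrow>\<^sub>0 nat) \<subseteq> {..<N}"
proof -
  obtain N N' where "Poly_Mapping.keys al \<subseteq> {..<N}" "Poly_Mapping.keys be \<subseteq> {..<N'}"
    using keys_finite_bound by meson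
  then show ?thesis by (intro exI[of _ "max N N'"]) auto
qed

lemma HL_Z_eq:
  assumes "Poly_Mapping.keys al \<subseteq> {..<N}" "Poly_Mapping.keys be \<subseteq> {..<N}"
  shows "HL_Z (al, be) = kernel_co N al be"
proof -
  have "ps_scale 1 f = f" for f :: fps2 by (simp add: ps_scale_def fun_eq_iff)
  then show ?thesis using HL_weighted_sum[OF assms, of "\<lambda>_. 1"] by (simp add: HL_Z_def)
qed

lemma HL_moment_eq:
  "fsum (\<lambda>lam. ps_scale (w (psize lam)) (tensor (HLQ lam) (HLP lam))) {lam. is_partition lam}
    = (\<lambda>m. w (pdeg (fst m)) * HL_Z m)"
proof
  fix m :: "(nat \<Rightarrow>\<^sub>0 nat) \<times> (nat \<Rightarrow>\<^sub>0 nat)"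
  obtain al be where m: "m = (al, be)" by (cases m)
  obtain N where N: "Poly_Mapping.keys al \<subseteq> {..<N}" "Poly_Mapping.keys be \<subseteq> {..<N}"
    using exponents_bound by blast
  show "fsum (\<lambda>lam. ps_scale (w (psize lam)) (tensor (HLQ lam) (HLP lam))) {lam. is_partition lam} m
    = w (pdeg (fst m)) * HL_Z m"
    by (simp add: m HL_weighted_sum[OF N] HL_Z_eq[OF N])
qed

lemma HL_Z_0: "HL_Z (0, 0) = 1"
  using HL_Z_eq[of 0 0 0] by (simp add: kernel_co_def qco_zero_sum)

text \<open>A nonzero term of the product picks x_i^k y_j^k from the power sums, so the terms are
  indexed by triples (k, i, j) and match those of \<open>kernel_co_newton\<close>. The index is
  unique because k >= 1; at k = 0 all i would give the same exponent.\<close>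

lemma euler_HL_Z: "euler HL_Z = ps_mult HL_Z (powsum_series (\<lambda>k. 1 - tt ^ k))"
proof
  fix m :: "(nat \<Rightarrow>\<^sub>0 nat) \<times> (nat \<Rightarrow>\<^sub>0 nat)"
  let ?A = "powsum_series (\<lambda>k. 1 - tt ^ k)"
  let ?s = "\<lambda>i k. Poly_Mapping.single i k :: nat \<Rightarrow>\<^sub>0 nat"
  obtain al be where m: "m = (al, be)" by (cases m)
  obtain N where N: "Poly_Mapping.keys al \<subseteq> {..<N}" "Poly_Mapping.keys be \<subseteq> {..<N}"
    using exponents_bound by blast
  define I where "I = {(k, i, j). k \<in> {1..pdeg be} \<and> i < N \<and> j < N \<and> k \<le> Poly_Mapping.lookup al i \<and> k \<le> Poly_Mapping.lookup be j}"
  define psi where "psi = (\<lambda>(k, i, j). ((al - ?s i k, be - ?s j k), (?s i k, ?s j k)))"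
  have le_deg: "Poly_Mapping.lookup be j \<le> pdeg be" if "j < N" for j
    unfolding pdeg_superset[OF finite_lessThan N(2)] using that by (intro member_le_sum) auto
  have inj: "inj_on psi I"
  proof (rule inj_onI)
    fix p q assume pq: "p \<in> I" "q \<in> I" "psi p = psi q"
    obtain k i j where p: "p = (k, i, j)" by (cases p)
    obtain k' i' j' where q: "q = (k', i', j')" by (cases q)
    have "?s i k = ?s i' k'" "?s j k = ?s j' k'" "k \<ge> 1" using pq by (auto simp: psi_def p q I_def)
    then show "p = q"
      unfolding p q by (metis lookup_single_eq lookup_single_not_eq not_one_le_zero)
  qed
  have "ps_mult HL_Z ?A m = (\<Sum>p\<in>psi ` I. HL_Z (fst p) * ?A (snd p))"
    unfolding ps_mult_altdef case_prod_beta
  proof (rule sum.mono_neutral_right)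
    show "psi ` I \<subseteq> {p. fst p + snd p = m}"
      by (auto simp: psi_def I_def m diff_single_add)
    show "finite {p. fst p + snd p = m}" using finite_decompositions[of m] unfolding case_prod_unfold .
    show "\<forall>p\<in>{p. fst p + snd p = m} - psi ` I. HL_Z (fst p) * ?A (snd p) = 0"
    proof
      fix p assume p: "p \<in> {p. fst p + snd p = m} - psi ` I"
      obtain a1 a2 b1 b2 where pe: "p = ((a1, a2), (b1, b2))" by (metis surj_pair)
      show "HL_Z (fst p) * ?A (snd p) = 0"
      proof (cases "?A (b1, b2) = 0")
        case False
        then obtain k i j where k: "k \<ge> 1" "b1 = ?s i k" "b2 = ?s j k"
          using powsum_series_nonzeroD by blast
        have ab: "al = a1 + ?s i k" "be = a2 + ?s j k" using p by (auto simp: pe m k)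
        have "k \<le> Poly_Mapping.lookup al i" "k \<le> Poly_Mapping.lookup be j" by (simp_all add: ab lookup_add)
        moreover have "i < N" "j < N"
          using N k(1) by (auto simp: ab in_keys_iff lookup_add subset_iff)
        moreover have "k \<le> pdeg be" using le_deg[OF \<open>j < N\<close>] \<open>k \<le> Poly_Mapping.lookup be j\<close> by simp
        ultimately have "(k, i, j) \<in> I" using k(1) by (simp add: I_def)
        moreover have "p = psi (k, i, j)" by (simp add: pe psi_def ab k)
        ultimately show ?thesis using p by blast
      qed (simp add: pe)
    qed
  qed
  also have "\<dots> = (\<Sum>p\<in>I. HL_Z (fst (psi p)) * ?A (snd (psi p)))"
    by (simp add: sum.reindex[OF inj])
  also have "\<dots> = (\<Sum>(k,i,j)\<in>I. (1 - tt ^ k) * kernel_co N (al - ?s i k) (be - ?s j k))"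
  proof (rule sum.cong[OF refl], clarify)
    fix k i j assume "(k, i, j) \<in> I"
    then have k: "1 \<le> k" by (simp add: I_def)
    have "HL_Z (al - ?s i k, be - ?s j k) = kernel_co N (al - ?s i k) (be - ?s j k)"
      by (rule HL_Z_eq) (use N keys_diff_subset in blast)+
    then show "HL_Z (fst (psi (k, i, j))) * ?A (snd (psi (k, i, j))) = (1 - tt ^ k) * kernel_co N (al - ?s i k) (be - ?s j k)"
      by (simp only: psi_def prod.case fst_conv snd_conv powsum_series_single[OF k] mult.commute)
  qed
  also have "\<dots> = (\<Sum>(k,i,j)\<in>{1..pdeg be} \<times> {..<N} \<times> {..<N}.
      if k \<le> Poly_Mapping.lookup al i \<and> k \<le> Poly_Mapping.lookup be j
      then (1 - tt ^ k) * kernel_co N (al - ?s i k) (be - ?s j k) else 0)"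
    by (rule sum.mono_neutral_cong_left) (auto simp: I_def split: if_splits)
  also have "\<dots> = of_nat (pdeg be) * kernel_co N al be"
    unfolding kernel_co_newton[OF N(2)] by (simp add: sum.cartesian_product)
  \<comment> \<open>Newton's recursion weighs by the degree in Y, \<open>euler\<close> by that in X;
    they agree wherever the kernel is nonzero.\<close>
  also have "\<dots> = of_nat (pdeg al) * kernel_co N al be"
    using kernel_co_homogeneous[OF _ N(2), of al] by (cases "kernel_co N al be = 0") auto
  also have "\<dots> = euler HL_Z m"
    by (simp add: euler_def m HL_Z_eq[OF N])
  finally show "euler HL_Z m = ps_mult HL_Z ?A m" ..
qed

theorem theorem5p1:
  shows "HL_mean = fsum (\<lambda>k. ps_scale (1 - tt ^ k) (tensor (powsum k) (powsum k))) {1..}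
       \<and> HL_var = fsum (\<lambda>k. ps_scale (of_nat k * (1 - tt ^ k)) (tensor (powsum k) (powsum k))) {1..}"
proof -
  let ?A = "powsum_series (\<lambda>k. 1 - tt ^ k)"
  have "fsum (\<lambda>lam. ps_scale (of_nat (psize lam)) (tensor (HLQ lam) (HLP lam))) {lam. is_partition lam} = euler HL_Z"
    unfolding HL_moment_eq[of of_nat] by (simp add: euler_def fun_eq_iff)
  then have mean: "HL_mean = ?A"
    unfolding HL_mean_def by (intro ps_div_eqI HL_Z_0) (simp add: euler_HL_Z)
  have "fsum (\<lambda>lam. ps_scale (of_nat (psize lam ^ 2)) (tensor (HLQ lam) (HLP lam))) {lam. is_partition lam}
    = euler (euler HL_Z)"
    unfolding HL_moment_eq[of "\<lambda>d. of_nat (d ^ 2)"]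
    by (simp add: euler_def fun_eq_iff power2_eq_square mult.assoc)
  \<comment> \<open>D(Z A) = (D Z) A + Z (D A) = Z (A A + D A). Subtracting the squared mean leaves
    D A, which has the extra factor k at p_k(X) p_k(Y).\<close>
  moreover have "euler (euler HL_Z) = ps_mult HL_Z (\<lambda>m. ps_mult ?A ?A m + euler ?A m)"
    by (simp only: euler_HL_Z euler_ps_mult ps_mult_assoc ps_mult_add_right)
  ultimately have "HL_second_moment = (\<lambda>m. ps_mult ?A ?A m + euler ?A m)"
    unfolding HL_second_moment_def by (intro ps_div_eqI HL_Z_0) simp
  then have "HL_var = euler ?A"
    unfolding HL_var_def mean by (simp add: ps_minus_def fun_eq_iff)
  then show ?thesis
    using mean euler_powsum_series[of "\<lambda>k. 1 - tt ^ k"] unfolding powsum_series_def by simp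
qed

end
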